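(* Let $(G,\mathcal{P})$ be a $k$-admissible pinned graph with $m\ge1$ pinned vertices, and fix a $k$-admissible construction order $\mathcal{O}=(v_1,\dots,v_l)$ (so $\mathcal{P}=\{v_1,\dots,v_m\}$). Let $E\subset\mathbb{R}^d$ be compact with $\dim(E)>\frac{d+k}{2}$, let $\mu$ be an $s$-Frostman measure on $E$ with $s>\frac{d+k}{2}$, and let $E_1,\dots,E_l\subset E$ be pairwise separated compact subsets with $\mu(E_i)>0$. Then $\mu_{E_1}\times\cdots\times\mu_{E_m}$-almost every $(x_1,\dots,x_m)\in E_1\times\cdots\times E_m$ is good for $(G,\mathcal{P},\mathcal{O},\{E_i\}_{i=1}^l)$.
   Context: A pinned graph $(G,\mathcal{P})$: finite simple graph $G=(\mathcal{V},\mathcal{E})$ with pinned vertices $\mathcal{P}$, no two adjacent, $m=|\mathcal{P}|$. A construction order lists $\mathcal{V}$ as $v_1,\dots,v_l$ with $v_1,\dots,v_m$ the pins. For $r>m$, $\eta_r=\{i<r: v_i\text{ adjacent to }v_r\}$, $\epsilon_r=|\eta_r|$ (back-degree); the order is $k$-admissible if $\epsilon_r\le k$ for all $r>m$, and $(G,\mathcal{P})$ is $k$-admissible if such an order exists. For points $(z_i)_{i\in\eta_r}$ in $\mathbb{R}^d$, $d^{\epsilon_r\text{-star}}_{(z_i)_{i\in\eta_r}}(y)=(|z_i-y|)_{i\in\eta_r}\in\mathbb{R}^{\epsilon_r}$. A measure on $\mathbb{R}^j$ is "in $L^2$" if it is absolutely continuous w.r.t. Lebesgue measure with $L^2$ density.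 A Borel $F'\subset F$ is $\mu_F$-full if $\mu_F(F')=\mu_F(F)$. Given $x=(x_1,\dots,x_m)$ and points $y_{m+1},\dots,y_{r-1}$, write $z_i=x_i$ for $i\le m$ and $z_i=y_i$ for $m<i<r$, and let $C_r$ be the condition "$(d^{\epsilon_r\text{-star}}_{(z_i)_{i\in\eta_r}})_*(\mu_{E_r})\in L^2(\mathbb{R}^{\epsilon_r})$". $x\in E_1\times\cdots\times E_m$ is good for $(G,\mathcal{P},\mathcal{O},\{E_i\})$ if: (1) $C_{m+1}$ holds for $x$; and (2) for each $m+1\le r\le l-1$ there are $\mu_{E_r}$-full sets $(E_r)_{x,y_{m+1},\dots,y_{r-1}}\subset E_r$, defined whenever $y_{m+1}\in(E_{m+1})_x$, $y_{m+2}\in(E_{m+2})_{x,y_{m+1}}$, …, $y_{r-1}\in(E_{r-1})_{x,y_{m+1},\dots,y_{r-2}}$, such that for every such $y_{m+1},\dots,y_{r-1}$ and every $y_r\in(E_r)_{x,y_{m+1},\dots,y_{r-1}}$, condition $C_{r+1}$ holds for $x,y_{m+1},\dots,y_r$. An $s$-Frostman measure on compact $E$ is a finite nonzero Borel measure supported on $E$ with $\mu(B(x,r))\le Cr^s$; $\mu_F(A)=\mu(A\cap F)$. *)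

theory Defs
  imports "HOL-Analysis.Analysis" "HOL-Probability.Probability"
begin

definition hausdorff_measure :: "real \<Rightarrow> 'a::metric_space set \<Rightarrow> ennreal" where
  "hausdorff_measure s A =
     (SUP \<delta>\<in>{0<..}. INF U\<in>{U :: nat \<Rightarrow> 'a set. A \<subseteq> (\<Union>i. U i) \<and>
                                 (\<forall>i. bounded (U i) \<and> diameter (U i) \<le> \<delta>)}.
        (\<Sum>i. ennreal (diameter (U i) powr s)))"

definition hausdorff_dim :: "'a::metric_space set \<Rightarrow> real" where
  "hausdorff_dim A = Inf {s. s \<ge> 0 \<and> hausdorff_measure s A = 0}"

definition frostman :: "real \<Rightarrow> 'a::euclidean_space measure \<Rightarrow> 'a set \<Rightarrow> bool" where
  "frostman s \<mu> E \<longleftrightarrow>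
     sets \<mu> = sets borel \<and> emeasure \<mu> UNIV < \<infinity> \<and> emeasure \<mu> UNIV \<noteq> 0 \<and>
     emeasure \<mu> (UNIV - E) = 0 \<and>
     (\<exists>C. \<forall>x r. r > 0 \<longrightarrow> measure \<mu> (ball x r) \<le> C * r powr s)"

definition restr_meas :: "'a measure \<Rightarrow> 'a set \<Rightarrow> 'a measure" where
  "restr_meas \<mu> F = density \<mu> (indicator F)"

definition leb :: "nat set \<Rightarrow> (nat \<Rightarrow> real) measure" where
  "leb I = Pi\<^sub>M I (\<lambda>_. lborel)"

definition in_L2 :: "nat set \<Rightarrow> (nat \<Rightarrow> real) measure \<Rightarrow> bool" where
  "in_L2 I \<nu> \<longleftrightarrow> (\<exists>f. f \<in> borel_measurable (leb I) \<and> \<nu> = density (leb I) f \<and>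
                       (\<integral>\<^sup>+ y. (f y)\<^sup>2 \<partial>leb I) < \<infinity>)"

text \<open>The construction order is v : {1..l} \<rightarrow> V; eta r = back-neighbours (indices) of v r.\<close>
definition eta :: "('v \<Rightarrow> 'v \<Rightarrow> bool) \<Rightarrow> (nat \<Rightarrow> 'v) \<Rightarrow> nat \<Rightarrow> nat set" where
  "eta adj v r = {i. 1 \<le> i \<and> i < r \<and> adj (v i) (v r)}"

definition k_admissible_order ::
  "nat \<Rightarrow> 'v set \<Rightarrow> ('v \<Rightarrow> 'v \<Rightarrow> bool) \<Rightarrow> 'v set \<Rightarrow> nat \<Rightarrow> nat \<Rightarrow> (nat \<Rightarrow> 'v) \<Rightarrow> bool" where
  "k_admissible_order k V adj P m l v \<longleftrightarrow>
     m \<le> l \<and> bij_betw v {1..l} V \<and> v ` {1..m} = P \<and>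
     (\<forall>r. m < r \<and> r \<le> l \<longrightarrow> card (eta adj v r) \<le> k)"

definition pinned_graph :: "'v set \<Rightarrow> ('v \<Rightarrow> 'v \<Rightarrow> bool) \<Rightarrow> 'v set \<Rightarrow> bool" where
  "pinned_graph V adj P \<longleftrightarrow> finite V \<and> P \<subseteq> V \<and>
     (\<forall>a b. adj a b \<longrightarrow> a \<in> V \<and> b \<in> V) \<and>
     (\<forall>a b. adj a b \<longrightarrow> adj b a) \<and> (\<forall>a. \<not> adj a a) \<and>
     (\<forall>a\<in>P. \<forall>b\<in>P. \<not> adj a b)"

definition k_admissible_pinned :: "nat \<Rightarrow> 'v set \<Rightarrow> ('v \<Rightarrow> 'v \<Rightarrow> bool) \<Rightarrow> 'v set \<Rightarrow> bool" where
  "k_admissible_pinned k V adj P \<longleftrightarrow> pinned_graph V adj P \<and>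
     (\<exists>l v. k_admissible_order k V adj P (card P) l v)"

text \<open>Condition C_r for the points z_1, ..., z_{r-1} (z_i = x_i for i \<le> m).\<close>
definition cond_C ::
  "'a::euclidean_space measure \<Rightarrow> (nat \<Rightarrow> 'a set) \<Rightarrow> ('v \<Rightarrow> 'v \<Rightarrow> bool) \<Rightarrow> (nat \<Rightarrow> 'v)
     \<Rightarrow> nat \<Rightarrow> (nat \<Rightarrow> 'a) \<Rightarrow> bool" where
  "cond_C \<mu> E adj v r z \<longleftrightarrow>
     in_L2 (eta adj v r)
       (distr (restr_meas \<mu> (E r)) (leb (eta adj v r)) (\<lambda>y. \<lambda>i\<in>eta adj v r. dist (z i) y))"

text \<open>z is an admissible choice up to (excluding) index r, w.r.t. the family F of full sets:
  z_i = x_i for i \<le> m and z_j \<in> (E_j)_{x,z_{m+1},...,z_{j-1}} for m < j < r.\<close>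
definition admissible_upto ::
  "nat \<Rightarrow> (nat \<Rightarrow> 'a) \<Rightarrow> (nat \<Rightarrow> (nat \<Rightarrow> 'a) \<Rightarrow> 'a set) \<Rightarrow> nat \<Rightarrow> (nat \<Rightarrow> 'a) \<Rightarrow> bool" where
  "admissible_upto m x F r z \<longleftrightarrow>
     (\<forall>i\<in>{1..m}. z i = x i) \<and>
     (\<forall>j. m < j \<and> j < r \<longrightarrow> z j \<in> F j (restrict z {1..<j}))"

definition good ::
  "'a::euclidean_space measure \<Rightarrow> (nat \<Rightarrow> 'a set) \<Rightarrow> ('v \<Rightarrow> 'v \<Rightarrow> bool) \<Rightarrow> (nat \<Rightarrow> 'v)
     \<Rightarrow> nat \<Rightarrow> nat \<Rightarrow> (nat \<Rightarrow> 'a) \<Rightarrow> bool" where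
  "good \<mu> E adj v m l x \<longleftrightarrow>
     (m < l \<longrightarrow> cond_C \<mu> E adj v (m + 1) x) \<and>
     (\<exists>F :: nat \<Rightarrow> (nat \<Rightarrow> 'a) \<Rightarrow> 'a set.
        \<forall>r z. m + 1 \<le> r \<and> r \<le> l - 1 \<and> admissible_upto m x F r z \<longrightarrow>
          F r (restrict z {1..<r}) \<in> sets borel \<and>
          F r (restrict z {1..<r}) \<subseteq> E r \<and>
          emeasure \<mu> (F r (restrict z {1..<r})) = emeasure \<mu> (E r) \<and>
          (\<forall>y\<in>F r (restrict z {1..<r}). cond_C \<mu> E adj v (r + 1) (z(r := y))))"

end

theory Submission
  imports Defs "HOL-Real_Asymp.Real_Asymp"
begin

text \<open>
  For measures \<open>\<mu>\<close> as in the theorem the energy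
  \<open>\<integral>\<integral> (\<epsilon>\<^bsup>-1\<^esup> \<mu> {z. \<bar>\<bar>z - x\<bar> - \<bar>z - y\<bar>\<bar> < \<epsilon>})\<^sup>j d\<mu> d\<mu>\<close> stays bounded as \<open>\<epsilon> \<rightarrow> 0\<close> whenever \<open>d + j < 2s\<close>.
  Integrated over the centres of a \<open>j\<close>-star, the \<open>\<epsilon>\<close>-scale approximation of the squared \<open>L\<^sup>2\<close> norm of its
  distance measure is at most this energy, so by Fatou almost every choice of centres yields a
  measure in \<open>L\<^sup>2\<close>; the sets of good choices are then peeled off one coordinate at a time by Fubini.

  For the energy bound, replace distances by squared distances and the cut-off by a Gaussian.  Since
  \<open>\<bar>z - x\<bar>\<^sup>2 - \<bar>z - y\<bar>\<^sup>2 = \<bar>x\<bar>\<^sup>2 - \<bar>y\<bar>\<^sup>2 - 2 z \<bullet> (x - y)\<close>, each slab factor is an integral over \<open>r\<close> and \<open>z\<close> of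
  the phases with frequencies \<open>r\<close> for \<open>\<bar>x\<bar>\<^sup>2\<close> and \<open>-2rz\<close> for \<open>x\<close>.  Averaging
  over \<open>z\<close> smears the frequency \<open>-2rz\<close> and turns, by the Frostman condition, a Gaussian frequency
  window of width \<open>\<rho>\<close> into at most \<open>(R/\<rho>)\<^bsup>d-s\<^esup>\<close> times a normalised window of width \<open>2R\<close>, where
  \<open>R = max \<bar>r\<bar> \<rho>\<close>.  Integrating over \<open>r\<close> and inducting on \<open>j\<close> gives the growth \<open>\<rho>\<^bsup>j-s\<^esup>\<close>.
\<close>

section \<open>Gaussian integrals\<close>

lemma le_suminf:
  fixes g :: "nat \<Rightarrow> ennreal"
  shows "g n \<le> suminf g"
  using sum_le_suminf[of g "{n}"] by simp

text \<open>The Gaussian is dominated by a series of multiples of indicators of balls: where n is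
  the integer part of |z - a| / t, its value is at most exp(-n^2) and z lies in the ball of radius
  (n + 1) t. The ball condition then yields t^s times a sum that depends on neither centre nor
  scale, convergent since exp(-n^2) beats (n + 1)^s.\<close>

lemma frostman_gaussian_bound:
  fixes \<mu> :: "'a::euclidean_space measure"
  assumes [measurable_cong]: "sets \<mu> = sets borel" and fin: "finite_measure \<mu>"
    and C: "\<And>x r. r > 0 \<Longrightarrow> measure \<mu> (ball x r) \<le> C * r powr s"
  obtains K where "K \<ge> 0"
    "\<And>a t. t > 0 \<Longrightarrow> (\<integral>\<^sup>+z. ennreal (exp (- (norm (z - a) / t)\<^sup>2)) \<partial>\<mu>) \<le> ennreal (K * t powr s)"
proof -
  interpret finite_measure \<mu> by fact
  define c where "c n = exp (- (real n)\<^sup>2) * (C * (real n + 1) powr s)" for n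
  have C0: "C \<ge> 0" using order_trans[OF measure_nonneg C[of 1 0]] by simp
  have sum_c: "summable c"
  proof (rule summable_comparison_test_bigo)
    show "summable (\<lambda>n. norm (1 / real n ^ 2))"
      using inverse_power_summable[of 2, where 'a=real] by (simp add: field_simps)
    show "c \<in> O(\<lambda>n. 1 / real n ^ 2)"
      unfolding c_def by real_asymp
  qed
  have c0: "c n \<ge> 0" for n using C0 by (simp add: c_def)
  show thesis
  proof (rule that[of "suminf c"])
    show "suminf c \<ge> 0" using sum_c c0 by (rule suminf_nonneg)
    fix a :: 'a and t :: real assume t: "t > 0"
    have "(\<integral>\<^sup>+z. ennreal (exp (- (norm (z - a) / t)\<^sup>2)) \<partial>\<mu>)
      \<le> (\<integral>\<^sup>+z. (\<Sum>n. ennreal (exp (- (real n)\<^sup>2)) * indicator (ball a ((real n + 1) * t)) z) \<partial>\<mu>)"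
    proof (rule nn_integral_mono)
      fix z :: 'a
      define n where "n = nat \<lfloor>norm (z - a) / t\<rfloor>"
      have n1: "real n \<le> norm (z - a) / t" and n2: "norm (z - a) / t < real n + 1"
        unfolding n_def using t by (simp_all add: of_nat_nat)
      have "z \<in> ball a ((real n + 1) * t)"
        using n2 t by (simp add: dist_norm norm_minus_commute field_simps)
      then have "ennreal (exp (- (norm (z - a) / t)\<^sup>2)) \<le>
          ennreal (exp (- (real n)\<^sup>2)) * indicator (ball a ((real n + 1) * t)) z"
        using power_mono[OF n1, of 2] by (simp add: ennreal_leI)
      also have "\<dots> \<le> (\<Sum>n. ennreal (exp (- (real n)\<^sup>2)) * indicator (ball a ((real n + 1) * t)) z)"
        by (rule le_suminf)
      finally show "ennreal (exp (- (norm (z - a) / t)\<^sup>2)) \<le> \<dots>" .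
    qed
    also have "\<dots> = (\<Sum>n. ennreal (exp (- (real n)\<^sup>2)) * emeasure \<mu> (ball a ((real n + 1) * t)))"
      by (subst nn_integral_suminf, measurable) (simp_all add: nn_integral_cmult_indicator assms(1))
    also have "\<dots> \<le> (\<Sum>n. ennreal (c n * t powr s))"
    proof (rule suminf_le)
      fix n
      have "emeasure \<mu> (ball a ((real n + 1) * t)) \<le> ennreal (C * ((real n + 1) * t) powr s)"
        using C[of "(real n + 1) * t" a] t by (simp add: emeasure_eq_measure ennreal_leI)
      then have "ennreal (exp (- (real n)\<^sup>2)) * emeasure \<mu> (ball a ((real n + 1) * t))
         \<le> ennreal (exp (- (real n)\<^sup>2)) * ennreal (C * ((real n + 1) * t) powr s)"
        by (rule mult_left_mono) simp
      also have "\<dots> = ennreal (c n * t powr s)"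
        using t C0 by (simp add: c_def powr_mult ennreal_mult[symmetric] mult_ac)
      finally show "ennreal (exp (- (real n)\<^sup>2)) * emeasure \<mu> (ball a ((real n + 1) * t)) \<le> \<dots>" .
    qed auto
    also have "\<dots> = ennreal (suminf c * t powr s)"
      using sum_c c0 by (subst suminf_ennreal2) (auto intro: summable_mult2 simp: suminf_mult2)
    finally show "(\<integral>\<^sup>+z. ennreal (exp (- (norm (z - a) / t)\<^sup>2)) \<partial>\<mu>) \<le> ennreal (suminf c * t powr s)" .
  qed
qed

text \<open>This is the characteristic function of the standard normal law, rescaled by x = \<delta>
  r with t = q / \<delta>.\<close>

lemma gaussian_fourier_1d:
  fixes \<delta> q :: real
  assumes "\<delta> > 0"
  shows "integrable lborel (\<lambda>r. complex_of_real (exp (- (\<delta> * r)\<^sup>2 / 2)) * iexp (r * q))" (is ?I)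
    and "(\<integral>r. complex_of_real (exp (- (\<delta> * r)\<^sup>2 / 2)) * iexp (r * q) \<partial>lborel) =
      complex_of_real (sqrt (2 * pi) / \<delta> * exp (- (q / \<delta>)\<^sup>2 / 2))" (is ?E)
proof -
  define t where "t = q / \<delta>"
  have eq: "complex_of_real (exp (- x\<^sup>2 / 2)) * iexp (t * x) =
      sqrt (2 * pi) *\<^sub>R (std_normal_density x *\<^sub>R iexp (t * x))" for x
    by (simp add: std_normal_density_def scaleR_conv_of_real)
  have n: "integrable lborel (\<lambda>x. std_normal_density x *\<^sub>R iexp (t * x))"
    by (rule Bochner_Integration.integrable_bound[OF integrable_normal_density[of 1 0]])
       (auto simp: norm_mult)
  then have I1: "integrable lborel (\<lambda>x. complex_of_real (exp (- x\<^sup>2 / 2)) * iexp (t * x))"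
    unfolding eq by (intro integrable_scaleR_right n)
  have "(\<integral>x. std_normal_density x *\<^sub>R iexp (t * x) \<partial>lborel) = char std_normal_distribution t"
    unfolding char_def by (subst integral_density) auto
  then have E1: "(\<integral>x. complex_of_real (exp (- x\<^sup>2 / 2)) * iexp (t * x) \<partial>lborel) =
      complex_of_real (sqrt (2 * pi) * exp (- t\<^sup>2 / 2))"
    unfolding eq by (simp add: char_std_normal_distribution scaleR_conv_of_real)
  show ?I
    using lborel_integrable_real_affine[OF I1, of \<delta> 0] assms
    by (simp add: t_def mult_ac)
  show ?E
    using lborel_integral_real_affine[of \<delta> "\<lambda>x. complex_of_real (exp (- x\<^sup>2 / 2)) * iexp (t * x)" 0] assms E1
    by (simp add: t_def scaleR_conv_of_real field_simps)
qed

text \<open>Multiply by exp(i \<alpha>) and take real parts. The energies below carry such a phase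
  offset \<alpha>, and working with cosines keeps them real.\<close>

lemma integral_iexp_imp_cos:
  fixes w \<theta> :: "'b \<Rightarrow> real"
  assumes "integrable M (\<lambda>x. complex_of_real (w x) * iexp (\<theta> x))"
    and "(\<integral>x. complex_of_real (w x) * iexp (\<theta> x) \<partial>M) = complex_of_real c"
  shows "(\<integral>x. w x * cos (\<alpha> + \<theta> x) \<partial>M) = cos \<alpha> * c"
proof -
  have eq: "w x * cos (\<alpha> + \<theta> x) = Re (iexp \<alpha> * (complex_of_real (w x) * iexp (\<theta> x)))" for x
    by (simp add: cos_add algebra_simps flip: cis_conv_exp)
  have "(\<integral>x. w x * cos (\<alpha> + \<theta> x) \<partial>M) = Re (iexp \<alpha> * complex_of_real c)"
    unfolding eq using assms by (subst integral_Re) auto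
  then show ?thesis by (simp flip: cis_conv_exp)
qed

lemma gaussian_cos_1d:
  assumes "\<delta> > 0"
  shows "(\<integral>r. exp (- (\<delta> * r)\<^sup>2 / 2) * cos (\<alpha> + r * q) \<partial>lborel) =
      cos \<alpha> * (sqrt (2 * pi) / \<delta> * exp (- (q / \<delta>)\<^sup>2 / 2))"
  by (rule integral_iexp_imp_cos) (use gaussian_fourier_1d[OF assms, of q] in auto)

text \<open>Gaussian and character both split into factors over an orthonormal basis, so the
  integral is a product of one-dimensional ones at the parameter 1 / \<rho>.\<close>

lemma gaussian_fourier_euclidean:
  fixes X :: "'a::euclidean_space" and \<rho> :: real
  assumes \<rho>: "\<rho> > 0"
  defines "F \<equiv> \<lambda>\<eta>::'a. complex_of_real (exp (- (norm \<eta> / \<rho>)\<^sup>2 / 2)) * iexp (\<eta> \<bullet> X)"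
  shows "integrable lborel F"
    and "integral\<^sup>L lborel F = complex_of_real ((sqrt (2 * pi) * \<rho>) ^ DIM('a) * exp (- (\<rho> * norm X)\<^sup>2 / 2))"
proof -
  interpret product_sigma_finite "\<lambda>_::'a. lborel :: real measure" ..
  define f where "f b r = complex_of_real (exp (- (inverse \<rho> * r)\<^sup>2 / 2)) * iexp (r * (X \<bullet> b))" for b r
  have fi: "integrable lborel (f b)" for b
    unfolding f_def using gaussian_fourier_1d(1)[of "inverse \<rho>" "X \<bullet> b"] \<rho> by simp
  have fe: "integral\<^sup>L lborel (f b) = complex_of_real (sqrt (2 * pi) * \<rho> * exp (- (\<rho> * (X \<bullet> b))\<^sup>2 / 2))" for b
  proof -
    have *: "x / inverse \<rho> = x * \<rho>" for x by (simp add: divide_inverse)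
    show ?thesis
      unfolding f_def using gaussian_fourier_1d(2)[of "inverse \<rho>" "X \<bullet> b"] \<rho>
      by (simp only: * mult.commute[of _ \<rho>]) simp
  qed
  have sq: "(\<Sum>b\<in>Basis. (c * (Y \<bullet> b))\<^sup>2) = (c * norm Y)\<^sup>2" for c and Y :: 'a
  proof -
    have "(norm Y)\<^sup>2 = (\<Sum>b\<in>Basis. (Y \<bullet> b)\<^sup>2)"
      unfolding power2_norm_eq_inner euclidean_inner[of Y Y] by (simp add: power2_eq_square)
    then show ?thesis by (simp only: power_mult_distrib sum_distrib_left)
  qed
  have Ff: "F (\<Sum>b\<in>Basis. g b *\<^sub>R b) = (\<Prod>b\<in>Basis. f b (g b))" for g :: "'a \<Rightarrow> real"
  proof -
    let ?Y = "\<Sum>b\<in>Basis. g b *\<^sub>R b"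
    have g: "?Y \<bullet> b = g b" if "b \<in> Basis" for b
      using that by simp
    have n: "(norm ?Y / \<rho>)\<^sup>2 = (\<Sum>b\<in>Basis. (inverse \<rho> * g b)\<^sup>2)"
      using sq[of "inverse \<rho>" ?Y] g by (simp only: divide_inverse mult.commute[of _ "inverse \<rho>"]) simp
    have i: "?Y \<bullet> X = (\<Sum>b\<in>Basis. g b * (X \<bullet> b))"
      by (subst euclidean_inner) simp
    have e: "exp (- (\<Sum>b\<in>Basis. (inverse \<rho> * g b)\<^sup>2) / 2) =
        (\<Prod>b\<in>Basis. exp (- (inverse \<rho> * g b)\<^sup>2 / 2))"
      by (simp only: exp_sum[OF finite_Basis, symmetric]) (simp add: sum_negf sum_divide_distrib)
    show ?thesis
      unfolding F_def f_def n i e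
      by (simp add: prod.distrib exp_sum sum_distrib_left)
  qed
  have meas: "F \<in> borel_measurable borel" unfolding F_def by measurable
  have I: "integrable (\<Pi>\<^sub>M b\<in>(Basis::'a set). lborel) (\<lambda>g. \<Prod>b\<in>Basis. f b (g b))"
    by (rule product_integrable_prod) (use fi in auto)
  show "integrable lborel F"
    by (subst lborel_eq, subst integrable_distr_eq) (use meas I in \<open>auto simp: Ff\<close>)
  have "integral\<^sup>L lborel F = (\<integral>g. (\<Prod>b\<in>Basis. f b (g b)) \<partial>(\<Pi>\<^sub>M b\<in>(Basis::'a set). lborel))"
    by (subst lborel_eq, subst integral_distr) (use meas in \<open>auto simp: Ff\<close>)
  also have "\<dots> = (\<Prod>b\<in>(Basis::'a set). integral\<^sup>L lborel (f b))"
    by (rule product_integral_prod) (use fi in auto)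
  also have "\<dots> = complex_of_real (\<Prod>b\<in>(Basis::'a set). sqrt (2 * pi) * \<rho> * exp (- (\<rho> * (X \<bullet> b))\<^sup>2 / 2))"
    by (simp add: fe)
  also have "(\<Prod>b\<in>(Basis::'a set). sqrt (2 * pi) * \<rho> * exp (- (\<rho> * (X \<bullet> b))\<^sup>2 / 2)) =
      (sqrt (2 * pi) * \<rho>) ^ DIM('a) * exp (\<Sum>b\<in>Basis. - (\<rho> * (X \<bullet> b))\<^sup>2 / 2)"
    by (simp add: prod.distrib exp_sum)
  also have "(\<Sum>b\<in>Basis. - (\<rho> * (X \<bullet> b))\<^sup>2 / 2) = - (\<rho> * norm X)\<^sup>2 / 2"
    by (simp only: sq sum_negf flip: sum_divide_distrib)
  finally show "integral\<^sup>L lborel F = complex_of_real ((sqrt (2 * pi) * \<rho>) ^ DIM('a) * exp (- (\<rho> * norm X)\<^sup>2 / 2))" .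
qed

lemma gaussian_cos_euclidean:
  fixes X :: "'a::euclidean_space"
  assumes "\<rho> > 0"
  shows "(\<integral>\<eta>. exp (- (norm \<eta> / \<rho>)\<^sup>2 / 2) * cos (\<alpha> + \<eta> \<bullet> X) \<partial>lborel) =
      cos \<alpha> * ((sqrt (2 * pi) * \<rho>) ^ DIM('a) * exp (- (\<rho> * norm X)\<^sup>2 / 2))"
  by (rule integral_iexp_imp_cos) (use gaussian_fourier_euclidean[OF assms, of X] in auto)

text \<open>Fubini, legitimate since |cos| is at most 1 and w(x) K(p) is integrable on the product.
  In the applications x is a frequency parameter and p a pair of points; the interchange serves both
  to insert a Gaussian window and to expand a slab factor.\<close>

lemma integral_weighted_cos_swap:
  fixes w :: "'w \<Rightarrow> real" and K :: "'p \<Rightarrow> real" and \<theta> :: "'w \<Rightarrow> 'p \<Rightarrow> real"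
  assumes "sigma_finite_measure M" "sigma_finite_measure N"
    and w: "integrable M w" and K: "integrable N K"
    and \<theta>: "(\<lambda>(x, p). \<theta> x p) \<in> borel_measurable (M \<Otimes>\<^sub>M N)"
  shows "integrable (M \<Otimes>\<^sub>M N) (\<lambda>(x, p). w x * (K p * cos (\<theta> x p)))"
    and "(\<integral>x. w x * (\<integral>p. K p * cos (\<theta> x p) \<partial>N) \<partial>M) = (\<integral>p. K p * (\<integral>x. w x * cos (\<theta> x p) \<partial>M) \<partial>N)"
    and "integrable M (\<lambda>x. w x * (\<integral>p. K p * cos (\<theta> x p) \<partial>N))"
proof -
  interpret M: sigma_finite_measure M by fact
  interpret N: sigma_finite_measure N by fact
  interpret pair_sigma_finite M N ..
  note [measurable] = borel_measurable_integrable[OF w] borel_measurable_integrable[OF K]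
  have [measurable]: "(\<lambda>z. \<theta> (fst z) (snd z)) \<in> borel_measurable (M \<Otimes>\<^sub>M N)"
    using \<theta> by (simp add: case_prod_beta')
  have "integrable (M \<Otimes>\<^sub>M N) (\<lambda>(x, p). w x * K p)"
  proof (rule Fubini_integrable)
    show "integrable M (\<lambda>x. \<integral>y. norm (case (x, y) of (x, p) \<Rightarrow> w x * K p) \<partial>N)"
      using w by (simp add: abs_mult)
    show "AE x in M. integrable N (\<lambda>y. case (x, y) of (x, p) \<Rightarrow> w x * K p)"
      using K by simp
  qed measurable
  then show I: "integrable (M \<Otimes>\<^sub>M N) (\<lambda>(x, p). w x * (K p * cos (\<theta> x p)))"
    by (rule Bochner_Integration.integrable_bound)
       (auto simp: abs_mult case_prod_beta' mult_left_le intro!: mult_left_mono)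
  have e: "(\<integral>x. w x * (K p * cos (\<theta> x p)) \<partial>M) = K p * (\<integral>x. w x * cos (\<theta> x p) \<partial>M)" for p
    by (simp add: mult.left_commute[of "w _"])
  show "(\<integral>x. w x * (\<integral>p. K p * cos (\<theta> x p) \<partial>N) \<partial>M) = (\<integral>p. K p * (\<integral>x. w x * cos (\<theta> x p) \<partial>M) \<partial>N)"
    using Fubini_integral[OF I] by (simp add: e)
  show "integrable M (\<lambda>x. w x * (\<integral>p. K p * cos (\<theta> x p) \<partial>N))"
    using integrable_fst[OF I] by simp
qed

lemma integrable_gaussian_euclidean:
  "\<rho> > 0 \<Longrightarrow> integrable lborel (\<lambda>\<eta>::'a::euclidean_space. exp (- (norm \<eta> / \<rho>)\<^sup>2 / 2))"
  using integrable_norm[OF gaussian_fourier_euclidean(1)[of \<rho> "0::'a"]] by simp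

lemma integrable_gaussian_1d:
  "\<delta> > 0 \<Longrightarrow> integrable lborel (\<lambda>r::real. exp (- (\<delta> * r)\<^sup>2 / 2))"
  using integrable_norm[OF gaussian_fourier_1d(1)[of \<delta> 0]] by simp

lemma nn_integral_translate_lborel:
  fixes c :: "'a::euclidean_space"
  assumes [measurable]: "f \<in> borel_measurable borel"
  shows "(\<integral>\<^sup>+x. f (c + x) \<partial>lborel) = (\<integral>\<^sup>+x. f x \<partial>lborel)"
  by (subst (2) lborel_distr_plus[of c, symmetric], subst nn_integral_distr) auto

text \<open>Substituting r = \<rho> t extracts \<rho>^(p + 1) and leaves the case \<rho> = 1, where
  the integrand is 1 on [-1, 1] and |t|^p outside, integrable at infinity because p < -1. The
  frequency integral in the induction on j has this form.\<close>

lemma nn_integral_max_powr: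
  fixes p :: real
  assumes p: "p < -1"
  obtains K where "K \<ge> 0" "\<And>\<rho>. \<rho> > 0 \<Longrightarrow> (\<integral>\<^sup>+r. ennreal (max \<bar>r\<bar> \<rho> powr p) \<partial>lborel) = ennreal (K * \<rho> powr (p + 1))"
proof -
  let ?h = "\<lambda>t::real. ennreal (t powr p) * indicator {1..} t"
  have h: "(\<integral>\<^sup>+t. ?h t \<partial>lborel) = ennreal (0 - 1 powr (p + 1) / (p + 1))"
  proof (rule nn_integral_FTC_atLeast[where F="\<lambda>t. t powr (p + 1) / (p + 1)"])
    show "((\<lambda>t. t powr (p + 1) / (p + 1)) has_real_derivative t powr p) (at t)" if "1 \<le> t" for t
      using that p by (auto intro!: derivative_eq_intros)
    show "((\<lambda>t. t powr (p + 1) / (p + 1)) \<longlongrightarrow> 0) at_top"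
      using p by real_asymp
  qed auto
  have "(\<integral>\<^sup>+t. ennreal (max \<bar>t\<bar> 1 powr p) \<partial>lborel) \<le>
      (\<integral>\<^sup>+t. indicator {-1..1} t + (?h t + ?h (-t)) \<partial>lborel)"
  proof (rule nn_integral_mono)
    fix t :: real
    show "ennreal (max \<bar>t\<bar> 1 powr p) \<le> indicator {-1..1} t + (?h t + ?h (-t))"
      by (cases "t \<le> -1"; cases "1 \<le> t") (auto simp: max_def indicator_def)
  qed
  also have "\<dots> = (\<integral>\<^sup>+t. indicator {-1..1::real} t \<partial>lborel) + ((\<integral>\<^sup>+t. ?h t \<partial>lborel) + (\<integral>\<^sup>+t. ?h (-t) \<partial>lborel))"
  proof -
    have add3: "(\<integral>\<^sup>+t. f t + (g t + h t) \<partial>lborel) = (\<integral>\<^sup>+t. f t \<partial>lborel) + ((\<integral>\<^sup>+t. g t \<partial>lborel) + (\<integral>\<^sup>+t. h t \<partial>lborel))"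
      if [measurable]: "f \<in> borel_measurable borel" "g \<in> borel_measurable borel" "h \<in> borel_measurable borel"
      for f g h :: "real \<Rightarrow> ennreal"
      by (simp add: nn_integral_add)
    show ?thesis
      by (rule add3[of "indicator {-1..1}" ?h "\<lambda>t. ?h (-t)"]) measurable
  qed
  also have "(\<integral>\<^sup>+t. ?h (-t) \<partial>lborel) = (\<integral>\<^sup>+t. ?h t \<partial>lborel)"
    by (subst (2) nn_integral_real_affine[where c="-1" and t=0]) auto
  also have "(\<integral>\<^sup>+t. indicator {-1..1::real} t \<partial>lborel) + ((\<integral>\<^sup>+t. ?h t \<partial>lborel) + (\<integral>\<^sup>+t. ?h t \<partial>lborel)) < \<infinity>"
    by (simp add: h ennreal_add_eq_top flip: top.not_eq_extremum)
  finally obtain K where K: "K \<ge> 0" "(\<integral>\<^sup>+t. ennreal (max \<bar>t\<bar> 1 powr p) \<partial>lborel) = ennreal K"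
    by (metis ennreal_cases infinity_ennreal_def less_irrefl)
  show thesis
  proof (rule that[of K])
    fix \<rho> :: real assume \<rho>: "\<rho> > 0"
    have "max \<bar>\<rho> * t\<bar> \<rho> powr p = \<rho> powr p * max \<bar>t\<bar> 1 powr p" for t
    proof -
      have "max \<bar>\<rho> * t\<bar> \<rho> = \<rho> * max \<bar>t\<bar> 1"
        using \<rho> by (simp add: abs_mult max_mult_distrib_left)
      then show ?thesis using \<rho> by (simp add: powr_mult)
    qed
    then show "(\<integral>\<^sup>+r. ennreal (max \<bar>r\<bar> \<rho> powr p) \<partial>lborel) = ennreal (K * \<rho> powr (p + 1))"
      using \<rho> K
      by (subst nn_integral_real_affine[where c=\<rho> and t=0])
         (auto simp: ennreal_mult nn_integral_cmult powr_add mult_ac)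
  qed fact
qed

section \<open>Energies of a Frostman measure\<close>

text \<open>The set carrying \<mu> is represented by a radius \<open>D\<close>. It bounds the
  frequency shifts -2rz by 2 |r| D, and it lets differences of distances control differences of
  squared distances.\<close>

locale frostman_measure = finite_measure \<mu>
  for \<mu> :: "'a::euclidean_space measure" +
  fixes s D C :: real
  assumes sets_eq: "sets \<mu> = sets borel"
    and D: "D > 0" and support: "AE z in \<mu>. norm z \<le> D"
    and ball_bound: "\<And>x r. r > 0 \<Longrightarrow> measure \<mu> (ball x r) \<le> C * r powr s"
begin

lemma measurable_cong_borel [measurable_cong]: "sets \<mu> = sets borel"
  by (rule sets_eq)

lemma space_eq [simp]: "space \<mu> = UNIV"
  using sets_eq_imp_space_eq[OF sets_eq] by simp

sublocale P: pair_sigma_finite \<mu> \<mu> ..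

sublocale PP: finite_measure "\<mu> \<Otimes>\<^sub>M \<mu>"
  by (rule finite_measure_pair_measure) unfold_locales

lemma sigma_finite_PP: "sigma_finite_measure (\<mu> \<Otimes>\<^sub>M \<mu>)"
  by unfold_locales

text \<open>The phase, at frequency (a, b), of a pair of points lifted to the paraboloid by x ->
  (|x|^2, x). A difference of squared distances from z is linear in the lifted points, which is why
  squares replace distances.\<close>

definition phase :: "real \<Rightarrow> 'a \<Rightarrow> 'a \<times> 'a \<Rightarrow> real" where
  "phase a b p = a * ((norm (fst p))\<^sup>2 - (norm (snd p))\<^sup>2) + b \<bullet> (fst p - snd p)"

lemma phase_measurable [measurable (raw)]:
  assumes [measurable]: "f \<in> borel_measurable M" "g \<in> borel_measurable M" 
    "(\<lambda>x. fst (h x)) \<in> borel_measurable M" "(\<lambda>x. snd (h x)) \<in> borel_measurable M"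
  shows "(\<lambda>x. phase (f x) (g x) (h x)) \<in> borel_measurable M"
  unfolding phase_def by measurable

definition sqdist_diff :: "'a \<Rightarrow> 'a \<times> 'a \<Rightarrow> real" where
  "sqdist_diff z p = (norm (z - fst p))\<^sup>2 - (norm (z - snd p))\<^sup>2"

lemma sqdist_diff_measurable [measurable (raw)]:
  assumes [measurable]: "g \<in> borel_measurable M" 
    "(\<lambda>x. fst (h x)) \<in> borel_measurable M" "(\<lambda>x. snd (h x)) \<in> borel_measurable M"
  shows "(\<lambda>x. sqdist_diff (g x) (h x)) \<in> borel_measurable M"
  unfolding sqdist_diff_def by measurable

text \<open>The term |z|^2 cancels in \<open>sqdist_diff\<close>, so r times it is again a phase, of
  frequency (r, -2rz). Slab factors can therefore be traded for translations in frequency.\<close>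

lemma phase_shift: "phase (a + r) (b - (2 * r) *\<^sub>R z) p = phase a b p + r * sqdist_diff z p"
  by (simp add: phase_def sqdist_diff_def power2_norm_eq_inner algebra_simps inner_commute)

text \<open>Up to constants, a smooth version of 1 / \<delta> times the mass of the z whose squared
  distances to the two points differ by less than \<delta>. The factor sqrt(2 pi) / \<delta> makes
  it exactly the integral over r and z of exp(-(\<delta> r)^2 / 2) cos(r
  \<open>sqdist_diff z p\<close>).\<close>

definition slab :: "real \<Rightarrow> 'a \<times> 'a \<Rightarrow> real" where
  "slab \<delta> p = (\<integral>z. sqrt (2 * pi) / \<delta> * exp (- (sqdist_diff z p / \<delta>)\<^sup>2 / 2) \<partial>\<mu>)"

lemma slab_measurable [measurable]: "slab \<delta> \<in> borel_measurable (borel \<Otimes>\<^sub>M borel)"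
  unfolding slab_def[abs_def] by measurable

lemma slab_integrable:
  assumes "\<delta> > 0"
  shows "integrable \<mu> (\<lambda>z. sqrt (2 * pi) / \<delta> * exp (- (sqdist_diff z p / \<delta>)\<^sup>2 / 2))"
proof (rule integrable_const_bound)
  show "AE z in \<mu>. norm (sqrt (2 * pi) / \<delta> * exp (- (sqdist_diff z p / \<delta>)\<^sup>2 / 2)) \<le> sqrt (2 * pi) / \<delta> * 1"
    using assms unfolding norm_mult by (intro AE_I2 mult_mono) auto
qed measurable

lemma slab_nonneg: "\<delta> > 0 \<Longrightarrow> 0 \<le> slab \<delta> p"
  unfolding slab_def by (rule Bochner_Integration.integral_nonneg) simp

lemma slab_le:
  assumes "\<delta> > 0"
  shows "slab \<delta> p \<le> sqrt (2 * pi) / \<delta> * measure \<mu> UNIV"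
proof -
  have "slab \<delta> p \<le> (\<integral>z. sqrt (2 * pi) / \<delta> \<partial>\<mu>)"
    unfolding slab_def using assms
    by (intro integral_mono slab_integrable) (auto simp: divide_simps)
  then show ?thesis by (simp add: mult.commute)
qed

text \<open>
  The scale \<open>\<delta>\<close> is proportional to the \<open>\<epsilon>\<close> of the slabs and all bounds are uniform in it; \<open>\<rho>\<close> is the width of the
  Gaussian frequency window around the modulation \<open>(a, b)\<close>, over which the induction on \<open>j\<close> runs.
\<close>

definition kern :: "nat \<Rightarrow> real \<Rightarrow> real \<Rightarrow> 'a \<times> 'a \<Rightarrow> real" where
  "kern j \<delta> \<rho> p = slab \<delta> p ^ j * exp (- (\<rho> * norm (fst p - snd p))\<^sup>2 / 2)"

lemma kern_integrable:
  assumes "\<delta> > 0"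
  shows "integrable (\<mu> \<Otimes>\<^sub>M \<mu>) (kern j \<delta> \<rho>)"
proof (rule PP.integrable_const_bound)
  show "AE p in \<mu> \<Otimes>\<^sub>M \<mu>. norm (kern j \<delta> \<rho> p) \<le> (sqrt (2 * pi) / \<delta> * measure \<mu> UNIV) ^ j * 1"
  proof (rule AE_I2)
    fix p
    have "slab \<delta> p ^ j * exp (- (\<rho> * norm (fst p - snd p))\<^sup>2 / 2) \<le>
        (sqrt (2 * pi) / \<delta> * measure \<mu> UNIV) ^ j * 1"
      using slab_nonneg[OF assms] slab_le[OF assms] assms
      by (intro mult_mono power_mono) auto
    then show "norm (kern j \<delta> \<rho> p) \<le> (sqrt (2 * pi) / \<delta> * measure \<mu> UNIV) ^ j * 1"
      using slab_nonneg[OF assms] by (simp add: kern_def abs_mult power_abs)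
  qed
qed (simp add: kern_def[abs_def])

lemma kern_measurable [measurable]: "kern j \<delta> \<rho> \<in> borel_measurable (borel \<Otimes>\<^sub>M borel)"
  unfolding kern_def[abs_def] by measurable

text \<open>At a = b = 0 this is the smoothed energy to be bounded. The modulation (a, b) is carried
  along because expanding a slab factor moves the frequency, so the induction on j has to cover all
  frequencies at once.\<close>

definition J :: "nat \<Rightarrow> real \<Rightarrow> real \<Rightarrow> real \<Rightarrow> 'a \<Rightarrow> real" where
  "J j \<delta> \<rho> a b = (\<integral>p. kern j \<delta> \<rho> p * cos (phase a b p) \<partial>(\<mu> \<Otimes>\<^sub>M \<mu>))"

lemma J_measurable [measurable (raw)]:
  assumes [measurable]: "f \<in> borel_measurable M" "g \<in> borel_measurable M"
  shows "(\<lambda>x. J j \<delta> \<rho> (f x) (g x)) \<in> borel_measurable M"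
  unfolding J_def by measurable

text \<open>The squared modulus, at (a, b), of the Fourier transform of \<mu> lifted to the
  paraboloid.\<close>

definition N :: "real \<Rightarrow> 'a \<Rightarrow> real" where
  "N a b = (\<integral>p. cos (phase a b p) \<partial>(\<mu> \<Otimes>\<^sub>M \<mu>))"

lemma N_measurable [measurable (raw)]:
  assumes [measurable]: "f \<in> borel_measurable M" "g \<in> borel_measurable M"
  shows "(\<lambda>x. N (f x) (g x)) \<in> borel_measurable M"
  unfolding N_def by measurable

text \<open>With \<phi> the phase of a single point, the addition formula for cos(\<phi> x - \<phi>
  y) makes the double integral a sum of two squares. The positivity of all \<open>J\<close> rests on
  this.\<close>

lemma N_nonneg: "N a b \<ge> 0"
proof -
  define \<phi> where "\<phi> x = a * (norm x)\<^sup>2 + b \<bullet> x" for x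
  have [measurable]: "\<phi> \<in> borel_measurable borel" unfolding \<phi>_def by measurable
  have i: "integrable \<mu> (\<lambda>x. cos (\<phi> x))" "integrable \<mu> (\<lambda>x. sin (\<phi> x))"
    by (rule integrable_const_bound[where B=1]; simp)+
  have "integrable (\<mu> \<Otimes>\<^sub>M \<mu>) (\<lambda>(x, y). cos (\<phi> x - \<phi> y))"
    by (rule PP.integrable_const_bound[where B=1]) auto
  from P.integral_fst[OF this]
  have "N a b = (\<integral>x. (\<integral>y. cos (\<phi> x - \<phi> y) \<partial>\<mu>) \<partial>\<mu>)"
    by (simp add: N_def phase_def \<phi>_def case_prod_beta' algebra_simps)
  also have "\<dots> = (\<integral>x. cos (\<phi> x) \<partial>\<mu>)\<^sup>2 + (\<integral>x. sin (\<phi> x) \<partial>\<mu>)\<^sup>2"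
    using i by (simp add: cos_diff power2_eq_square)
  finally show ?thesis by simp
qed

text \<open>Averaging the frequency b against a Gaussian of width \<rho> produces, by the Gaussian
  Fourier transform in x - y, the factor exp(-(\<rho> |x - y|)^2 / 2) of \<open>kern\<close>. So
  \<open>J 0\<close> is a normalised window average of \<open>N\<close>, and inherits its
  sign.\<close>

lemma ennreal_J_0:
  assumes \<rho>: "\<rho> > 0"
  shows "(\<integral>\<^sup>+\<eta>. ennreal (exp (- (norm \<eta> / \<rho>)\<^sup>2 / 2) * N a (b + \<eta>)) \<partial>lborel)
    = ennreal ((sqrt (2 * pi) * \<rho>) ^ DIM('a) * J 0 \<delta> \<rho> a b)" and "0 \<le> J 0 \<delta> \<rho> a b"
proof -
  let ?w = "\<lambda>\<eta>::'a. exp (- (norm \<eta> / \<rho>)\<^sup>2 / 2)"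
  note swap = integral_weighted_cos_swap[OF sigma_finite_lborel sigma_finite_PP
      integrable_gaussian_euclidean[OF \<rho>], where K="\<lambda>_. 1" and \<theta>="\<lambda>\<eta>. phase a (b + \<eta>)"]
  have m: "(\<lambda>(x, p). phase a (b + x) p) \<in> borel_measurable (lborel \<Otimes>\<^sub>M (\<mu> \<Otimes>\<^sub>M \<mu>))"
    by measurable
  have ph: "phase a (b + \<eta>) p = phase a b p + \<eta> \<bullet> (fst p - snd p)" for \<eta> p
    by (simp add: phase_def inner_add_left)
  have "(\<integral>\<eta>. ?w \<eta> * N a (b + \<eta>) \<partial>lborel) =
     (\<integral>p. 1 * (\<integral>\<eta>. ?w \<eta> * cos (phase a (b + \<eta>) p) \<partial>lborel) \<partial>(\<mu> \<Otimes>\<^sub>M \<mu>))"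
    using swap(2)[OF _ m] unfolding N_def by simp
  also have "\<dots> = (\<integral>p. (sqrt (2 * pi) * \<rho>) ^ DIM('a) * (kern 0 \<delta> \<rho> p * cos (phase a b p)) \<partial>(\<mu> \<Otimes>\<^sub>M \<mu>))"
    unfolding ph gaussian_cos_euclidean[OF \<rho>] by (simp add: kern_def mult_ac)
  also have "\<dots> = (sqrt (2 * pi) * \<rho>) ^ DIM('a) * J 0 \<delta> \<rho> a b"
    by (simp add: J_def)
  finally have eq: "(\<integral>\<eta>. ?w \<eta> * N a (b + \<eta>) \<partial>lborel) = (sqrt (2 * pi) * \<rho>) ^ DIM('a) * J 0 \<delta> \<rho> a b" .
  have "(\<integral>\<eta>. ?w \<eta> * N a (b + \<eta>) \<partial>lborel) \<ge> 0"
    by (rule Bochner_Integration.integral_nonneg) (simp add: N_nonneg)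
  moreover have pos: "(sqrt (2 * pi) * \<rho>) ^ DIM('a) > 0" using \<rho> by simp
  ultimately show "0 \<le> J 0 \<delta> \<rho> a b"
    unfolding eq using pos by (metis zero_le_mult_iff not_le)
  have "(\<integral>\<^sup>+\<eta>. ennreal (?w \<eta> * N a (b + \<eta>)) \<partial>lborel) = ennreal (\<integral>\<eta>. ?w \<eta> * N a (b + \<eta>) \<partial>lborel)"
    by (rule nn_integral_eq_integral) (use swap(3)[OF _ m] N_nonneg in \<open>auto simp: N_def\<close>)
  then show "(\<integral>\<^sup>+\<eta>. ennreal (?w \<eta> * N a (b + \<eta>)) \<partial>lborel)
    = ennreal ((sqrt (2 * pi) * \<rho>) ^ DIM('a) * J 0 \<delta> \<rho> a b)" unfolding eq .
qed

text \<open>The additional slab factor is an integral over (r, z); \<open>phase_shift\<close>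
  absorbs its oscillation into the frequency, and Fubini moves the integral over pairs inside. Thus
  \<open>J (Suc j)\<close> is an average of \<open>J j\<close> over shifted frequencies with
  positive weights.\<close>

lemma integral_J_Suc:
  assumes \<delta>: "\<delta> > 0"
  shows "(\<integral>x. exp (- (\<delta> * fst x)\<^sup>2 / 2) * J j \<delta> \<rho> (a + fst x) (b - (2 * fst x) *\<^sub>R snd x) \<partial>(lborel \<Otimes>\<^sub>M \<mu>)) = J (Suc j) \<delta> \<rho> a b"
    and "integrable (lborel \<Otimes>\<^sub>M \<mu>) (\<lambda>x. exp (- (\<delta> * fst x)\<^sup>2 / 2) * J j \<delta> \<rho> (a + fst x) (b - (2 * fst x) *\<^sub>R snd x))"
proof -
  interpret L: pair_sigma_finite "lborel :: real measure" \<mu> ..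
  have sf: "sigma_finite_measure ((lborel :: real measure) \<Otimes>\<^sub>M \<mu>)" by unfold_locales
  let ?w = "\<lambda>x::real \<times> 'a. exp (- (\<delta> * fst x)\<^sup>2 / 2)"
  let ?\<theta> = "\<lambda>x::real \<times> 'a. phase (a + fst x) (b - (2 * fst x) *\<^sub>R snd x)"
  have w: "integrable (lborel \<Otimes>\<^sub>M \<mu>) ?w"
  proof (rule L.Fubini_integrable)
    show "integrable lborel (\<lambda>x. \<integral>y. norm (?w (x, y)) \<partial>\<mu>)"
      using integrable_gaussian_1d[OF \<delta>] by simp
  qed auto
  have m: "(\<lambda>(x, p). ?\<theta> x p) \<in> borel_measurable ((lborel \<Otimes>\<^sub>M \<mu>) \<Otimes>\<^sub>M (\<mu> \<Otimes>\<^sub>M \<mu>))"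
    by measurable
  note swap = integral_weighted_cos_swap[OF sf sigma_finite_PP w
      kern_integrable[OF \<delta>, of j \<rho>] m]
  have inner: "(\<integral>x. ?w x * cos (?\<theta> x p) \<partial>(lborel \<Otimes>\<^sub>M \<mu>)) = slab \<delta> p * cos (phase a b p)" for p
  proof -
    have "integrable (lborel \<Otimes>\<^sub>M \<mu>) (\<lambda>x. ?w x * cos (?\<theta> x p))"
      by (rule Bochner_Integration.integrable_bound[OF w]) (auto simp: abs_mult)
    then have "integrable (lborel \<Otimes>\<^sub>M \<mu>) (\<lambda>(r, z). exp (- (\<delta> * r)\<^sup>2 / 2) * cos (phase a b p + r * sqdist_diff z p))"
      by (simp add: phase_shift case_prod_beta')
    from L.integral_snd[OF this]
    have "(\<integral>x. ?w x * cos (?\<theta> x p) \<partial>(lborel \<Otimes>\<^sub>M \<mu>)) =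
       (\<integral>z. (\<integral>r. exp (- (\<delta> * r)\<^sup>2 / 2) * cos (phase a b p + r * sqdist_diff z p) \<partial>lborel) \<partial>\<mu>)"
      by (simp add: phase_shift case_prod_beta')
    also have "\<dots> = slab \<delta> p * cos (phase a b p)"
      unfolding gaussian_cos_1d[OF \<delta>] slab_def by simp
    finally show ?thesis .
  qed
  have "J (Suc j) \<delta> \<rho> a b = (\<integral>p. kern j \<delta> \<rho> p * (slab \<delta> p * cos (phase a b p)) \<partial>(\<mu> \<Otimes>\<^sub>M \<mu>))"
    unfolding J_def kern_def by (rule Bochner_Integration.integral_cong) simp_all
  moreover have "(\<integral>x. ?w x * J j \<delta> \<rho> (a + fst x) (b - (2 * fst x) *\<^sub>R snd x) \<partial>(lborel \<Otimes>\<^sub>M \<mu>)) =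
      (\<integral>p. kern j \<delta> \<rho> p * (slab \<delta> p * cos (phase a b p)) \<partial>(\<mu> \<Otimes>\<^sub>M \<mu>))"
    unfolding J_def swap(2) inner ..
  ultimately show "(\<integral>x. ?w x * J j \<delta> \<rho> (a + fst x) (b - (2 * fst x) *\<^sub>R snd x) \<partial>(lborel \<Otimes>\<^sub>M \<mu>)) = J (Suc j) \<delta> \<rho> a b"
    by (simp only:)
  show "integrable (lborel \<Otimes>\<^sub>M \<mu>) (\<lambda>x. ?w x * J j \<delta> \<rho> (a + fst x) (b - (2 * fst x) *\<^sub>R snd x))"
    unfolding J_def by (rule swap(3))
qed

text \<open>Positivity passes from \<open>J 0\<close> through each of the positively weighted
  averages in \<open>integral_J_Suc\<close>. It lets the further estimates run in nonnegative
  integrals, where the order of integration is free.\<close>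

lemma J_nonneg:
  assumes "\<delta> > 0" "\<rho> > 0"
  shows "0 \<le> J j \<delta> \<rho> a b"
proof (induction j arbitrary: a b)
  case 0
  then show ?case using ennreal_J_0(2)[OF assms(2)] .
next
  case (Suc j)
  show ?case
    unfolding integral_J_Suc(1)[OF assms(1), symmetric]
    by (rule Bochner_Integration.integral_nonneg) (simp add: Suc)
qed

lemma ennreal_J_Suc:
  assumes \<delta>: "\<delta> > 0" and \<rho>: "\<rho> > 0"
  shows "ennreal (J (Suc j) \<delta> \<rho> a b) = (\<integral>\<^sup>+x. ennreal (exp (- (\<delta> * fst x)\<^sup>2 / 2)) * ennreal (J j \<delta> \<rho> (a + fst x) (b - (2 * fst x) *\<^sub>R snd x)) \<partial>(lborel \<Otimes>\<^sub>M \<mu>))"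
proof -
  have "(\<integral>\<^sup>+x. ennreal (exp (- (\<delta> * fst x)\<^sup>2 / 2) * J j \<delta> \<rho> (a + fst x) (b - (2 * fst x) *\<^sub>R snd x)) \<partial>(lborel \<Otimes>\<^sub>M \<mu>))
     = ennreal (J (Suc j) \<delta> \<rho> a b)"
    unfolding integral_J_Suc(1)[OF \<delta>, symmetric]
    by (rule nn_integral_eq_integral[OF integral_J_Suc(2)[OF \<delta>]]) (simp add: J_nonneg[OF \<delta> \<rho>])
  then show ?thesis by (simp only: ennreal_mult'[OF exp_ge_zero])
qed

end

section \<open>Growth of the smoothed energies in the window width\<close>

context frostman_measure
begin

text \<open>With the cosine bounded by 1 there remains, for fixed x, a Gaussian in y of width sqrt 2
  / \<rho> about x, whose integral is at most a constant times \<rho>^(-s) by the ball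
  condition.\<close>

lemma J_0_bound:
  obtains K where "K \<ge> 0" "\<And>\<delta> \<rho> a b. \<lbrakk>\<delta> > 0; \<rho> > 0\<rbrakk> \<Longrightarrow> J 0 \<delta> \<rho> a b \<le> K * \<rho> powr (- s)"
proof -
  obtain K where K: "K \<ge> 0"
    "\<And>a t. t > 0 \<Longrightarrow> (\<integral>\<^sup>+z. ennreal (exp (- (norm (z - a) / t)\<^sup>2)) \<partial>\<mu>) \<le> ennreal (K * t powr s)"
    using frostman_gaussian_bound[OF sets_eq finite_measure_axioms ball_bound] by blast
  show thesis
  proof (rule that[of "K * sqrt 2 powr s * measure \<mu> UNIV"])
    fix \<delta> \<rho> :: real and a and b :: 'a assume \<delta>: "\<delta> > 0" and \<rho>: "\<rho> > 0"
    have k: "kern 0 \<delta> \<rho> (x, y) = exp (- (norm (y - x) / (sqrt 2 / \<rho>))\<^sup>2)" for x y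
      by (simp add: kern_def power_divide power_mult_distrib norm_minus_commute mult.commute)
    have "J 0 \<delta> \<rho> a b \<le> (\<integral>p. kern 0 \<delta> \<rho> p \<partial>(\<mu> \<Otimes>\<^sub>M \<mu>))"
      unfolding J_def
    proof (rule integral_mono)
      show i: "integrable (\<mu> \<Otimes>\<^sub>M \<mu>) (kern 0 \<delta> \<rho>)" by (rule kern_integrable[OF \<delta>])
      show "integrable (\<mu> \<Otimes>\<^sub>M \<mu>) (\<lambda>p. kern 0 \<delta> \<rho> p * cos (phase a b p))"
        by (rule Bochner_Integration.integrable_bound[OF i]) (auto simp: abs_mult mult_left_le)
    qed (simp add: kern_def mult_left_le)
    then have "ennreal (J 0 \<delta> \<rho> a b) \<le> ennreal (\<integral>p. kern 0 \<delta> \<rho> p \<partial>(\<mu> \<Otimes>\<^sub>M \<mu>))"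
      by (rule ennreal_leI)
    also have "\<dots> = (\<integral>\<^sup>+p. ennreal (kern 0 \<delta> \<rho> p) \<partial>(\<mu> \<Otimes>\<^sub>M \<mu>))"
      by (rule nn_integral_eq_integral[symmetric]) (simp_all add: kern_integrable[OF \<delta>], simp add: kern_def)
    also have "\<dots> = (\<integral>\<^sup>+x. \<integral>\<^sup>+y. ennreal (kern 0 \<delta> \<rho> (x, y)) \<partial>\<mu> \<partial>\<mu>)"
      by (rule nn_integral_fst[symmetric]) measurable
    also have "\<dots> \<le> (\<integral>\<^sup>+x. ennreal (K * (sqrt 2 / \<rho>) powr s) \<partial>\<mu>)"
      unfolding k by (intro nn_integral_mono K(2)) (use \<rho> in simp)
    also have "\<dots> = ennreal (K * sqrt 2 powr s * measure \<mu> UNIV * \<rho> powr (- s))"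
      using K(1) \<rho> by (simp add: emeasure_eq_measure ennreal_mult[symmetric] powr_divide powr_minus field_simps)
    finally show "J 0 \<delta> \<rho> a b \<le> K * sqrt 2 powr s * measure \<mu> UNIV * \<rho> powr (- s)"
      using K(1) by (subst (asm) ennreal_le_iff) auto
  qed (use K in simp)
qed

text \<open>For j = 0, a window of width \<rho> around b - 2rz is averaged over z. Put R = max |r|
  \<rho>. Part of each Gaussian is given up for a fixed window of width 2R about b; the rest,
  integrated over z, yields (\<rho>/R)^s by the ball condition, while normalising the windows costs
  (R/\<rho>)^d. Larger j follow because frequency translations commute, with the same
  constant.\<close>

lemma J_average_bound:
  obtains K where "K \<ge> 0" "\<And>j \<delta> \<rho> a b r. \<lbrakk>\<delta> > 0; \<rho> > 0\<rbrakk> \<Longrightarrow>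
    (\<integral>\<^sup>+z. ennreal (J j \<delta> \<rho> a (b - (2 * r) *\<^sub>R z)) \<partial>\<mu>)
      \<le> ennreal (K * (max \<bar>r\<bar> \<rho> / \<rho>) powr (real DIM('a) - s)) * ennreal (J j \<delta> (2 * max \<bar>r\<bar> \<rho>) a b)"
proof -
  obtain K where K: "K \<ge> 0"
    "\<And>a t. t > 0 \<Longrightarrow> (\<integral>\<^sup>+z. ennreal (exp (- (norm (z - a) / t)\<^sup>2)) \<partial>\<mu>) \<le> ennreal (K * t powr s)"
    using frostman_gaussian_bound[OF sets_eq finite_measure_axioms ball_bound] by blast
  \<comment> \<open>Two regimes: for |r| \<le> \<rho> the Gaussian is bounded by 1 and the total
    mass suffices; for |r| > \<rho> it is, as a function of z, a Gaussian of width \<rho> / |r|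
    about -\<xi> / (2r), to which \<open>K\<close> applies.\<close>
  define M where "M = max K (measure \<mu> UNIV)"
  have M: "M \<ge> 0" "K \<le> M" "measure \<mu> UNIV \<le> M" using K(1) by (auto simp: M_def)
  have gauss: "(\<integral>\<^sup>+z. ennreal (exp (- (norm (\<xi> + (2 * r) *\<^sub>R z) / (2 * \<rho>))\<^sup>2)) \<partial>\<mu>)
      \<le> ennreal (M * (\<rho> / max \<bar>r\<bar> \<rho>) powr s)" if \<rho>: "\<rho> > 0" for \<xi> r \<rho>
  proof (cases "\<bar>r\<bar> \<le> \<rho>")
    case True
    have "(\<integral>\<^sup>+z. ennreal (exp (- (norm (\<xi> + (2 * r) *\<^sub>R z) / (2 * \<rho>))\<^sup>2)) \<partial>\<mu>) \<le> (\<integral>\<^sup>+z. 1 \<partial>\<mu>)"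
      by (intro nn_integral_mono) simp
    also have "\<dots> \<le> ennreal M" using M by (simp add: emeasure_eq_measure)
    finally show ?thesis using True \<rho> by (simp add: max_def)
  next
    case False
    then have r: "r \<noteq> 0" "\<bar>r\<bar> > 0" using \<rho> by auto
    have eq: "norm (\<xi> + (2 * r) *\<^sub>R z) / (2 * \<rho>) = norm (z - (- (1 / (2 * r)) *\<^sub>R \<xi>)) / (\<rho> / \<bar>r\<bar>)" for z
    proof -
      have "\<xi> + (2 * r) *\<^sub>R z = (2 * r) *\<^sub>R (z - (- (1 / (2 * r)) *\<^sub>R \<xi>))"
        using r by (simp add: algebra_simps)
      then have "norm (\<xi> + (2 * r) *\<^sub>R z) = 2 * \<bar>r\<bar> * norm (z - (- (1 / (2 * r)) *\<^sub>R \<xi>))"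
        by (simp only: norm_scaleR abs_mult)
      then show ?thesis using r \<rho> by (simp add: field_simps)
    qed
    have "(\<integral>\<^sup>+z. ennreal (exp (- (norm (\<xi> + (2 * r) *\<^sub>R z) / (2 * \<rho>))\<^sup>2)) \<partial>\<mu>) \<le> ennreal (K * (\<rho> / \<bar>r\<bar>) powr s)"
      unfolding eq by (rule K(2)) (use r \<rho> in simp)
    also have "\<dots> \<le> ennreal (M * (\<rho> / \<bar>r\<bar>) powr s)"
      using M by (intro ennreal_leI mult_right_mono) auto
    finally show ?thesis using False by (simp add: max_def)
  qed
  \<comment> \<open>exp(D^2) is the loss in \<open>split\<close>; 2^d comes from normalising a
    window of width 2R instead of R.\<close>
  define K' where "K' = M * exp (D\<^sup>2) * 2 ^ DIM('a)"
  have K': "K' \<ge> 0" using M by (simp add: K'_def)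
  have step0: "(\<integral>\<^sup>+z. ennreal (J 0 \<delta> \<rho> a (b - (2 * r) *\<^sub>R z)) \<partial>\<mu>)
      \<le> ennreal (K' * (max \<bar>r\<bar> \<rho> / \<rho>) powr (real DIM('a) - s)) * ennreal (J 0 \<delta> (2 * max \<bar>r\<bar> \<rho>) a b)"
    if \<delta>: "\<delta> > 0" and \<rho>: "\<rho> > 0" for \<delta> \<rho> a b r
  proof -
    define R where "R = max \<bar>r\<bar> \<rho>"
    have R: "R > 0" "R \<ge> \<rho>" "R \<ge> \<bar>r\<bar>" using \<rho> by (auto simp: R_def)
    define c where "c = (sqrt (2 * pi) * \<rho>) ^ DIM('a)"
    have c: "c > 0" using \<rho> by (simp add: c_def)
    interpret L: pair_sigma_finite \<mu> "lborel :: 'a measure" ..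
    let ?w = "\<lambda>\<rho> \<eta>::'a. exp (- (norm \<eta> / \<rho>)\<^sup>2 / 2)"
    \<comment> \<open>Half of the exponent is kept for the integral over z. The other half pays for
      the wider window: with n = |\<xi> + 2rz|, the bound |\<xi>| \<le> n + 2RD gives (|\<xi>|/R)^2
      \<le> 2 (n/\<rho>)^2 + 8 D^2, and an eighth of the left side is the exponent of the window of
      width 2R.\<close>
    have split: "?w \<rho> (\<xi> + (2 * r) *\<^sub>R z) \<le>
        exp (D\<^sup>2) * ?w (2 * R) \<xi> * exp (- (norm (\<xi> + (2 * r) *\<^sub>R z) / (2 * \<rho>))\<^sup>2)"
      if z: "norm z \<le> D" for z \<xi>
    proof -
      let ?n = "norm (\<xi> + (2 * r) *\<^sub>R z)"
      have "norm \<xi> \<le> ?n + norm ((2 * r) *\<^sub>R z)"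
        using norm_triangle_ineq4[of "\<xi> + (2 * r) *\<^sub>R z" "(2 * r) *\<^sub>R z"] by simp
      also have "norm ((2 * r) *\<^sub>R z) \<le> 2 * R * D"
        using z R by (simp add: abs_mult) (intro mult_mono, auto)
      finally have "norm \<xi> / R \<le> ?n / R + 2 * D"
        using R by (simp add: field_simps)
      then have "(norm \<xi> / R)\<^sup>2 \<le> (?n / R + 2 * D)\<^sup>2"
        using R by (intro power_mono) auto
      also have "\<dots> \<le> 2 * (?n / R)\<^sup>2 + 2 * (2 * D)\<^sup>2"
        using sum_squares_bound[of "?n / R" "2 * D"] by (simp add: power2_sum)
      also have "(?n / R)\<^sup>2 \<le> (?n / \<rho>)\<^sup>2"
        using R \<rho> by (intro power_mono divide_left_mono) auto
      finally have "(norm \<xi> / R)\<^sup>2 \<le> 2 * (?n / \<rho>)\<^sup>2 + 8 * D\<^sup>2"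
        by (simp add: power_mult_distrib)
      then have "- (?n / \<rho>)\<^sup>2 / 2 \<le> D\<^sup>2 + (- (norm \<xi> / (2 * R))\<^sup>2 / 2) + (- (?n / (2 * \<rho>))\<^sup>2)"
        by (simp add: power_divide power_mult_distrib)
      then show ?thesis by (simp only: exp_add[symmetric] exp_le_cancel_iff)
    qed
    have "ennreal c * (\<integral>\<^sup>+z. ennreal (J 0 \<delta> \<rho> a (b - (2 * r) *\<^sub>R z)) \<partial>\<mu>)
        = (\<integral>\<^sup>+z. ennreal (c * J 0 \<delta> \<rho> a (b - (2 * r) *\<^sub>R z)) \<partial>\<mu>)"
      using c by (subst nn_integral_cmult[symmetric]) (auto simp: ennreal_mult')
    also have "\<dots> = (\<integral>\<^sup>+z. \<integral>\<^sup>+\<eta>. ennreal (?w \<rho> \<eta> * N a ((b - (2 * r) *\<^sub>R z) + \<eta>)) \<partial>lborel \<partial>\<mu>)"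
      unfolding c_def ennreal_J_0(1)[OF \<rho>, where \<delta>=\<delta>] ..
    \<comment> \<open>The substitution \<eta> = \<xi> + 2rz moves the dependence on z from
      \<open>N\<close> to the window.\<close>
    also have "\<dots> = (\<integral>\<^sup>+z. \<integral>\<^sup>+\<xi>. ennreal (?w \<rho> (\<xi> + (2 * r) *\<^sub>R z) * N a (b + \<xi>)) \<partial>lborel \<partial>\<mu>)"
    proof (rule nn_integral_cong)
      fix z
      show "(\<integral>\<^sup>+\<eta>. ennreal (?w \<rho> \<eta> * N a ((b - (2 * r) *\<^sub>R z) + \<eta>)) \<partial>lborel) =
          (\<integral>\<^sup>+\<xi>. ennreal (?w \<rho> (\<xi> + (2 * r) *\<^sub>R z) * N a (b + \<xi>)) \<partial>lborel)"
        by (subst nn_integral_translate_lborel[of _ "(2 * r) *\<^sub>R z", symmetric]) (auto simp: algebra_simps)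
    qed
    also have "\<dots> = (\<integral>\<^sup>+\<xi>. \<integral>\<^sup>+z. ennreal (?w \<rho> (\<xi> + (2 * r) *\<^sub>R z) * N a (b + \<xi>)) \<partial>\<mu> \<partial>lborel)"
      by (rule L.Fubini'[symmetric]) measurable
    also have "\<dots> \<le> (\<integral>\<^sup>+\<xi>. ennreal (exp (D\<^sup>2) * (M * (\<rho> / R) powr s)) * ennreal (?w (2 * R) \<xi> * N a (b + \<xi>)) \<partial>lborel)"
    proof (rule nn_integral_mono)
      fix \<xi> :: 'a
      let ?A = "exp (D\<^sup>2) * (?w (2 * R) \<xi> * N a (b + \<xi>))"
      have A: "?A \<ge> 0" by (simp add: N_nonneg)
      have "(\<integral>\<^sup>+z. ennreal (?w \<rho> (\<xi> + (2 * r) *\<^sub>R z) * N a (b + \<xi>)) \<partial>\<mu>) \<le>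
          (\<integral>\<^sup>+z. ennreal ?A * ennreal (exp (- (norm (\<xi> + (2 * r) *\<^sub>R z) / (2 * \<rho>))\<^sup>2)) \<partial>\<mu>)"
      proof (rule nn_integral_mono_AE)
        show "AE z in \<mu>. ennreal (?w \<rho> (\<xi> + (2 * r) *\<^sub>R z) * N a (b + \<xi>)) \<le>
           ennreal ?A * ennreal (exp (- (norm (\<xi> + (2 * r) *\<^sub>R z) / (2 * \<rho>))\<^sup>2))"
          using support
        proof eventually_elim
          case (elim z)
          from mult_right_mono[OF split[OF elim, of \<xi>] N_nonneg[of a "b + \<xi>"]]
          have "?w \<rho> (\<xi> + (2 * r) *\<^sub>R z) * N a (b + \<xi>) \<le> ?A * exp (- (norm (\<xi> + (2 * r) *\<^sub>R z) / (2 * \<rho>))\<^sup>2)"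
            by (simp only: mult_ac)
          then show ?case
            unfolding ennreal_mult'[OF A, symmetric] by (rule ennreal_leI)
        qed
      qed
      also have "\<dots> = ennreal ?A * (\<integral>\<^sup>+z. ennreal (exp (- (norm (\<xi> + (2 * r) *\<^sub>R z) / (2 * \<rho>))\<^sup>2)) \<partial>\<mu>)"
        by (rule nn_integral_cmult) measurable
      also have "\<dots> \<le> ennreal ?A * ennreal (M * (\<rho> / R) powr s)"
        unfolding R_def by (intro mult_left_mono gauss \<rho>) simp
      also have "\<dots> = ennreal (exp (D\<^sup>2) * (M * (\<rho> / R) powr s)) * ennreal (?w (2 * R) \<xi> * N a (b + \<xi>))"
        using M N_nonneg by (simp add: ennreal_mult[symmetric] mult_ac)
      finally show "(\<integral>\<^sup>+z. ennreal (?w \<rho> (\<xi> + (2 * r) *\<^sub>R z) * N a (b + \<xi>)) \<partial>\<mu>) \<le> \<dots>" .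
    qed
    also have "\<dots> = ennreal (exp (D\<^sup>2) * (M * (\<rho> / R) powr s)) * ennreal ((sqrt (2 * pi) * (2 * R)) ^ DIM('a) * J 0 \<delta> (2 * R) a b)"
      using ennreal_J_0(1)[of "2 * R" a b \<delta>] R by (subst nn_integral_cmult) simp_all
    also have "\<dots> = ennreal c * (ennreal (K' * (R / \<rho>) powr (real DIM('a) - s)) * ennreal (J 0 \<delta> (2 * R) a b))"
    proof -
      have "exp (D\<^sup>2) * (M * (\<rho> / R) powr s) * (sqrt (2 * pi) * (2 * R)) ^ DIM('a) =
          c * (K' * (R / \<rho>) powr (real DIM('a) - s))"
        using \<rho> R(1)
        by (simp add: c_def K'_def powr_diff powr_divide powr_realpow power_mult_distrib power_divide field_simps)
      then show ?thesis
        using M c K' R J_nonneg[OF \<delta>, of "2 * R" 0 a b]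
        by (simp add: ennreal_mult[symmetric] mult.assoc[symmetric])
    qed
    finally show ?thesis
      using c by (simp add: ennreal_mult_le_mult_iff R_def)
  qed
  show thesis
  proof (rule that[of K'])
    fix j :: nat and \<delta> \<rho> a r :: real and b :: 'a
    assume \<delta>: "\<delta> > 0" and \<rho>: "\<rho> > 0"
    show "(\<integral>\<^sup>+z. ennreal (J j \<delta> \<rho> a (b - (2 * r) *\<^sub>R z)) \<partial>\<mu>)
      \<le> ennreal (K' * (max \<bar>r\<bar> \<rho> / \<rho>) powr (real DIM('a) - s)) * ennreal (J j \<delta> (2 * max \<bar>r\<bar> \<rho>) a b)"
    proof (induction j arbitrary: a b)
      case 0
      show ?case by (rule step0[OF \<delta> \<rho>])
    next
      case (Suc j)
      let ?R = "max \<bar>r\<bar> \<rho>"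
      let ?k = "ennreal (K' * (?R / \<rho>) powr (real DIM('a) - s))"
      let ?e = "\<lambda>x::real \<times> 'a. ennreal (exp (- (\<delta> * fst x)\<^sup>2 / 2))"
      interpret L: pair_sigma_finite "lborel :: real measure" \<mu> ..
      have sf: "sigma_finite_measure ((lborel :: real measure) \<Otimes>\<^sub>M \<mu>)" by unfold_locales
      interpret Q: pair_sigma_finite \<mu> "(lborel :: real measure) \<Otimes>\<^sub>M \<mu>"
        using sf sigma_finite_measure_axioms by (intro pair_sigma_finite.intro)
      \<comment> \<open>Expanding the extra slab factor shifts b by -2 \<open>fst x\<close>
        \<open>snd x\<close>. This commutes with the shift by -2rz, so the induction hypothesis
        applies under the integral at the moved frequency.\<close>
      have "(\<integral>\<^sup>+z. ennreal (J (Suc j) \<delta> \<rho> a (b - (2 * r) *\<^sub>R z)) \<partial>\<mu>)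
        = (\<integral>\<^sup>+z. \<integral>\<^sup>+x. ?e x * ennreal (J j \<delta> \<rho> (a + fst x) ((b - (2 * fst x) *\<^sub>R snd x) - (2 * r) *\<^sub>R z)) \<partial>(lborel \<Otimes>\<^sub>M \<mu>) \<partial>\<mu>)"
        unfolding ennreal_J_Suc[OF \<delta> \<rho>] by (simp add: algebra_simps)
      also have "\<dots> = (\<integral>\<^sup>+x. \<integral>\<^sup>+z. ?e x * ennreal (J j \<delta> \<rho> (a + fst x) ((b - (2 * fst x) *\<^sub>R snd x) - (2 * r) *\<^sub>R z)) \<partial>\<mu> \<partial>(lborel \<Otimes>\<^sub>M \<mu>))"
        by (rule Q.Fubini'[symmetric]) measurable
      also have "\<dots> = (\<integral>\<^sup>+x. ?e x * (\<integral>\<^sup>+z. ennreal (J j \<delta> \<rho> (a + fst x) ((b - (2 * fst x) *\<^sub>R snd x) - (2 * r) *\<^sub>R z)) \<partial>\<mu>) \<partial>(lborel \<Otimes>\<^sub>M \<mu>))"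
        by (intro nn_integral_cong nn_integral_cmult) measurable
      also have "\<dots> \<le> (\<integral>\<^sup>+x. ?k * (?e x * ennreal (J j \<delta> (2 * ?R) (a + fst x) (b - (2 * fst x) *\<^sub>R snd x))) \<partial>(lborel \<Otimes>\<^sub>M \<mu>))"
      proof (rule nn_integral_mono)
        fix x :: "real \<times> 'a"
        show "?e x * (\<integral>\<^sup>+z. ennreal (J j \<delta> \<rho> (a + fst x) ((b - (2 * fst x) *\<^sub>R snd x) - (2 * r) *\<^sub>R z)) \<partial>\<mu>) \<le>
            ?k * (?e x * ennreal (J j \<delta> (2 * ?R) (a + fst x) (b - (2 * fst x) *\<^sub>R snd x)))"
          unfolding mult.left_commute[of ?k] by (intro mult_left_mono Suc.IH) simp
      qed
      also have "\<dots> = ?k * ennreal (J (Suc j) \<delta> (2 * ?R) a b)"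
        using ennreal_J_Suc[OF \<delta>, of "2 * ?R" j a b] \<rho> by (subst nn_integral_cmult) (auto simp: max_def)
      finally show ?case .
    qed
  qed (rule K')
qed

text \<open>In the step to j + 1, averaging over z leaves an integrand in r of at most a constant
  times \<rho>^(s-d) R^(d-s) R^(j-s), where R = max |r| \<rho>. Its integral converges because d + j
  + 1 < 2s and is of order \<rho>^(s-d) \<rho>^(d+j+1-2s), whence the exponent j + 1 - s.\<close>

lemma J_bound:
  assumes "real DIM('a) + real j < 2 * s"
  obtains K where "K \<ge> 0" "\<And>\<delta> \<rho> a b. \<lbrakk>\<delta> > 0; \<rho> > 0\<rbrakk> \<Longrightarrow> J j \<delta> \<rho> a b \<le> K * \<rho> powr (real j - s)"
  using assms
proof (induction j arbitrary: thesis)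
  case 0
  show ?case using J_0_bound 0 by (metis diff_0 of_nat_0)
next
  case (Suc j)
  obtain K where K: "K \<ge> 0" "\<And>\<delta> \<rho> a b. \<lbrakk>\<delta> > 0; \<rho> > 0\<rbrakk> \<Longrightarrow> J j \<delta> \<rho> a b \<le> K * \<rho> powr (real j - s)"
    using Suc.IH Suc.prems(2) by auto
  obtain A where A: "A \<ge> 0" "\<And>j \<delta> \<rho> a b r. \<lbrakk>\<delta> > 0; \<rho> > 0\<rbrakk> \<Longrightarrow>
    (\<integral>\<^sup>+z. ennreal (J j \<delta> \<rho> a (b - (2 * r) *\<^sub>R z)) \<partial>\<mu>)
      \<le> ennreal (A * (max \<bar>r\<bar> \<rho> / \<rho>) powr (real DIM('a) - s)) * ennreal (J j \<delta> (2 * max \<bar>r\<bar> \<rho>) a b)"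
    using J_average_bound by blast
  define p where "p = real DIM('a) + real j - 2 * s"
  have p: "p < -1" using Suc.prems(2) by (simp add: p_def)
  obtain B where B: "B \<ge> 0" "\<And>\<rho>. \<rho> > 0 \<Longrightarrow> (\<integral>\<^sup>+r. ennreal (max \<bar>r\<bar> \<rho> powr p) \<partial>lborel) = ennreal (B * \<rho> powr (p + 1))"
    using nn_integral_max_powr[OF p] by blast
  define E where "E = A * K * 2 powr (real j - s)"
  have E: "E \<ge> 0" using A K by (simp add: E_def)
  show ?case
  proof (rule Suc.prems(1)[of "E * B"])
    show "E * B \<ge> 0" using E B by simp
    fix \<delta> \<rho> a :: real and b :: 'a assume \<delta>: "\<delta> > 0" and \<rho>: "\<rho> > 0"
    interpret L: pair_sigma_finite "lborel :: real measure" \<mu> ..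
    let ?R = "\<lambda>r. max \<bar>r\<bar> \<rho>"
    have "ennreal (J (Suc j) \<delta> \<rho> a b) =
       (\<integral>\<^sup>+r. \<integral>\<^sup>+z. ennreal (exp (- (\<delta> * r)\<^sup>2 / 2)) * ennreal (J j \<delta> \<rho> (a + r) (b - (2 * r) *\<^sub>R z)) \<partial>\<mu> \<partial>lborel)"
      unfolding ennreal_J_Suc[OF \<delta> \<rho>] by (subst nn_integral_fst[symmetric]) (auto, measurable)
    \<comment> \<open>The Gaussian cut-off in r is bounded by 1, so that no \<delta> enters the
      constant.\<close>
    also have "\<dots> \<le> (\<integral>\<^sup>+r. \<integral>\<^sup>+z. ennreal (J j \<delta> \<rho> (a + r) (b - (2 * r) *\<^sub>R z)) \<partial>\<mu> \<partial>lborel)"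
      using mult_right_mono[of "ennreal (exp _)" 1] by (intro nn_integral_mono) simp
    also have "\<dots> \<le> (\<integral>\<^sup>+r. ennreal (E * \<rho> powr (s - real DIM('a))) * ennreal (?R r powr p) \<partial>lborel)"
    proof (rule nn_integral_mono)
      fix r :: real
      have R: "?R r > 0" using \<rho> by simp
      have "(\<integral>\<^sup>+z. ennreal (J j \<delta> \<rho> (a + r) (b - (2 * r) *\<^sub>R z)) \<partial>\<mu>) \<le>
         ennreal (A * (?R r / \<rho>) powr (real DIM('a) - s)) * ennreal (J j \<delta> (2 * ?R r) (a + r) b)"
        by (rule A(2)[OF \<delta> \<rho>])
      also have "\<dots> \<le> ennreal (A * (?R r / \<rho>) powr (real DIM('a) - s)) * ennreal (K * (2 * ?R r) powr (real j - s))"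
        using K(2)[OF \<delta>, of "2 * ?R r" "a + r" b] R by (intro mult_left_mono ennreal_leI) auto
      also have "\<dots> = ennreal (E * \<rho> powr (s - real DIM('a))) * ennreal (?R r powr p)"
      proof -
        have "(?R r / \<rho>) powr (real DIM('a) - s) * (2 * ?R r) powr (real j - s) =
            2 powr (real j - s) * \<rho> powr (s - real DIM('a)) * ?R r powr p"
        proof -
          have "?R r powr p = ?R r powr (real DIM('a) - s) * ?R r powr (real j - s)"
            by (simp add: p_def flip: powr_add)
          moreover have "\<rho> powr (s - real DIM('a)) = 1 / \<rho> powr (real DIM('a) - s)"
            using powr_minus_divide[of \<rho> "real DIM('a) - s"] by simp
          ultimately show ?thesis
            using R \<rho> by (simp add: powr_divide powr_mult)
        qed
        then have "A * (?R r / \<rho>) powr (real DIM('a) - s) * (K * (2 * ?R r) powr (real j - s)) =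
            E * \<rho> powr (s - real DIM('a)) * ?R r powr p"
          by (simp add: E_def mult_ac)
        then show ?thesis using A(1) K(1) E by (simp add: ennreal_mult[symmetric])
      qed
      finally show "(\<integral>\<^sup>+z. ennreal (J j \<delta> \<rho> (a + r) (b - (2 * r) *\<^sub>R z)) \<partial>\<mu>) \<le> \<dots>" .
    qed
    also have "\<dots> = ennreal (E * \<rho> powr (s - real DIM('a))) * ennreal (B * \<rho> powr (p + 1))"
      using B(2)[OF \<rho>] by (subst nn_integral_cmult) simp_all
    also have "\<dots> = ennreal (E * B * \<rho> powr (real (Suc j) - s))"
      using E B(1) by (simp add: ennreal_mult[symmetric] p_def mult_ac flip: powr_add) (simp add: algebra_simps)
    finally show "J (Suc j) \<delta> \<rho> a b \<le> E * B * \<rho> powr (real (Suc j) - s)"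
      using E B(1) by (subst (asm) ennreal_le_iff) auto
  qed
qed

text \<open>When x, y, z have norm at most D, a difference of distances below \<epsilon> forces a
  difference of squared distances of at most \<delta> = 4 D \<epsilon>, where the Gaussian in
  \<open>slab\<close> is at least exp(-1/2). The energy is then compared with \<open>J\<close> at
  \<rho> = 1 and frequency zero, which \<open>J_bound\<close> controls uniformly in
  \<delta>.\<close>

lemma slab_energy_bound:
  assumes "real DIM('a) + real j < 2 * s"
  obtains K where "K < \<infinity>" "\<And>\<epsilon>. \<epsilon> > 0 \<Longrightarrow>
    (\<integral>\<^sup>+p. (ennreal (1 / \<epsilon>) * emeasure \<mu> {z. \<bar>dist z (fst p) - dist z (snd p)\<bar> < \<epsilon>}) ^ j \<partial>(\<mu> \<Otimes>\<^sub>M \<mu>)) \<le> K"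
proof -
  obtain K where K: "K \<ge> 0" "\<And>\<delta> \<rho> a b. \<lbrakk>\<delta> > 0; \<rho> > 0\<rbrakk> \<Longrightarrow> J j \<delta> \<rho> a b \<le> K * \<rho> powr (real j - s)"
    using J_bound[OF assms] by blast
  \<comment> \<open>Chosen so that c sqrt(2 pi) / \<delta> exp(-1/2) = 1 / \<epsilon> for \<delta> =
    4 D \<epsilon>; the ratio of the scales is fixed, so c does not depend on \<epsilon>.\<close>
  define c where "c = 4 * D * exp (1 / 2) / sqrt (2 * pi)"
  have c: "c \<ge> 0" using D by (simp add: c_def)
  have AE_P: "AE p in \<mu> \<Otimes>\<^sub>M \<mu>. norm (fst p) \<le> D \<and> norm (snd p) \<le> D"
    using support by (subst P.AE_pair_iff[symmetric]) auto
  show thesis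
  proof (rule that[of "ennreal (c ^ j * exp (2 * D\<^sup>2) * K)"])
    fix \<epsilon> :: real assume \<epsilon>: "\<epsilon> > 0"
    define \<delta> where "\<delta> = 4 * D * \<epsilon>"
    have \<delta>: "\<delta> > 0" using D \<epsilon> by (simp add: \<delta>_def)
    have slab_ge: "ennreal (1 / \<epsilon>) * emeasure \<mu> {z. \<bar>dist z x - dist z y\<bar> < \<epsilon>} \<le> ennreal (c * slab \<delta> (x, y))"
      if x: "norm x \<le> D" and y: "norm y \<le> D" for x y
    proof -
      have "ennreal (1 / \<epsilon>) * emeasure \<mu> {z. \<bar>dist z x - dist z y\<bar> < \<epsilon>} =
          (\<integral>\<^sup>+z. ennreal (1 / \<epsilon>) * indicator {z. \<bar>dist z x - dist z y\<bar> < \<epsilon>} z \<partial>\<mu>)"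
        by (subst nn_integral_cmult_indicator) (auto simp: sets_eq)
      also have "\<dots> \<le> (\<integral>\<^sup>+z. ennreal (c * (sqrt (2 * pi) / \<delta> * exp (- (sqdist_diff z (x, y) / \<delta>)\<^sup>2 / 2))) \<partial>\<mu>)"
      proof (rule nn_integral_mono_AE)
        show "AE z in \<mu>. ennreal (1 / \<epsilon>) * indicator {z. \<bar>dist z x - dist z y\<bar> < \<epsilon>} z \<le>
           ennreal (c * (sqrt (2 * pi) / \<delta> * exp (- (sqdist_diff z (x, y) / \<delta>)\<^sup>2 / 2)))"
          using support
        proof eventually_elim
          case (elim z)
          show ?case
          proof (cases "\<bar>dist z x - dist z y\<bar> < \<epsilon>")
            case True
            have q: "sqdist_diff z (x, y) = (norm (z - x) - norm (z - y)) * (norm (z - x) + norm (z - y))"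
              by (simp add: sqdist_diff_def power2_eq_square algebra_simps)
            have "norm (z - x) + norm (z - y) \<le> 4 * D"
              using norm_triangle_ineq4[of z x] norm_triangle_ineq4[of z y] elim x y by linarith
            then have "\<bar>sqdist_diff z (x, y)\<bar> \<le> \<epsilon> * (4 * D)"
              unfolding q abs_mult using True \<epsilon> by (intro mult_mono) (auto simp: dist_norm)
            then have "\<bar>sqdist_diff z (x, y) / \<delta>\<bar> \<le> 1"
              using \<delta> by (simp add: \<delta>_def mult_ac)
            then have "(sqdist_diff z (x, y) / \<delta>)\<^sup>2 \<le> 1"
              by (simp add: abs_square_le_1)
            then have "exp (- 1 / 2) \<le> exp (- (sqdist_diff z (x, y) / \<delta>)\<^sup>2 / 2)"
              by simp
            then have "c * (sqrt (2 * pi) / \<delta> * exp (- 1 / 2)) \<le> c * (sqrt (2 * pi) / \<delta> * exp (- (sqdist_diff z (x, y) / \<delta>)\<^sup>2 / 2))"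
              using c \<delta> by (intro mult_left_mono) auto
            moreover have "c * (sqrt (2 * pi) / \<delta> * exp (- 1 / 2)) = 1 / \<epsilon>"
              using D \<epsilon> by (simp add: c_def \<delta>_def exp_minus field_simps)
            ultimately show ?thesis using True by (simp add: ennreal_leI)
          qed simp
        qed
      qed
      also have "\<dots> = ennreal (c * slab \<delta> (x, y))"
        unfolding slab_def integral_mult_right_zero[symmetric]
        by (rule nn_integral_eq_integral[OF integrable_mult_right[OF slab_integrable[OF \<delta>]]]) (use c \<delta> in simp)
      finally show ?thesis .
    qed
    have int: "integrable (\<mu> \<Otimes>\<^sub>M \<mu>) (\<lambda>p. c ^ j * exp (2 * D\<^sup>2) * kern j \<delta> 1 p)"
      using kern_integrable[OF \<delta>] by simp
    have kern0: "kern j \<delta> 1 p \<ge> 0" for p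
      using slab_nonneg[OF \<delta>] by (simp add: kern_def)
    have "(\<integral>\<^sup>+p. (ennreal (1 / \<epsilon>) * emeasure \<mu> {z. \<bar>dist z (fst p) - dist z (snd p)\<bar> < \<epsilon>}) ^ j \<partial>(\<mu> \<Otimes>\<^sub>M \<mu>))
      \<le> (\<integral>\<^sup>+p. ennreal (c ^ j * exp (2 * D\<^sup>2) * kern j \<delta> 1 p) \<partial>(\<mu> \<Otimes>\<^sub>M \<mu>))"
    proof (rule nn_integral_mono_AE)
      show "AE p in \<mu> \<Otimes>\<^sub>M \<mu>. (ennreal (1 / \<epsilon>) * emeasure \<mu> {z. \<bar>dist z (fst p) - dist z (snd p)\<bar> < \<epsilon>}) ^ j
          \<le> ennreal (c ^ j * exp (2 * D\<^sup>2) * kern j \<delta> 1 p)"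
        using AE_P
      proof eventually_elim
        case (elim p)
        have "norm (fst p - snd p) \<le> 2 * D"
          using norm_triangle_ineq4[of "fst p" "snd p"] elim by simp
        then have "(norm (fst p - snd p))\<^sup>2 \<le> (2 * D)\<^sup>2"
          by (intro power_mono) auto
        \<comment> \<open>On the support |x - y| \<le> 2D, so exp(2 D^2) compensates the Gaussian of
          \<open>kern\<close> at \<rho> = 1.\<close>
        then have e: "1 \<le> exp (2 * D\<^sup>2) * exp (- (1 * norm (fst p - snd p))\<^sup>2 / 2)"
          by (simp add: power_mult_distrib flip: exp_add)
        have "(ennreal (1 / \<epsilon>) * emeasure \<mu> {z. \<bar>dist z (fst p) - dist z (snd p)\<bar> < \<epsilon>}) ^ j \<le> ennreal (c * slab \<delta> p) ^ j"
          using slab_ge[of "fst p" "snd p"] elim by (intro power_mono) auto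
        also have "\<dots> = ennreal ((c * slab \<delta> p) ^ j * 1)"
          using c slab_nonneg[OF \<delta>] by (simp add: ennreal_power)
        also have "\<dots> \<le> ennreal ((c * slab \<delta> p) ^ j * (exp (2 * D\<^sup>2) * exp (- (1 * norm (fst p - snd p))\<^sup>2 / 2)))"
          using c slab_nonneg[OF \<delta>] e by (intro ennreal_leI mult_left_mono) auto
        also have "\<dots> = ennreal (c ^ j * exp (2 * D\<^sup>2) * kern j \<delta> 1 p)"
          by (simp add: kern_def power_mult_distrib mult_ac)
        finally show ?case .
      qed
    qed
    also have "\<dots> = ennreal (c ^ j * exp (2 * D\<^sup>2) * J j \<delta> 1 0 0)"
      using int kern0 c by (subst nn_integral_eq_integral) (auto simp: J_def phase_def)
    also have "\<dots> \<le> ennreal (c ^ j * exp (2 * D\<^sup>2) * K)"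
      using K(2)[OF \<delta>, of 1 0 0] c by (intro ennreal_leI mult_left_mono) auto
    finally show "(\<integral>\<^sup>+p. (ennreal (1 / \<epsilon>) * emeasure \<mu> {z. \<bar>dist z (fst p) - dist z (snd p)\<bar> < \<epsilon>}) ^ j \<partial>(\<mu> \<Otimes>\<^sub>M \<mu>))
      \<le> ennreal (c ^ j * exp (2 * D\<^sup>2) * K)" .
  qed simp
qed

end

section \<open>Square-integrable densities\<close>

lemma space_leb: "space (leb I) = (\<Pi>\<^sub>E i\<in>I. UNIV)"
  by (simp add: leb_def space_PiM)

lemma sigma_finite_leb: "finite I \<Longrightarrow> sigma_finite_measure (leb I)"
proof -
  assume "finite I"
  interpret product_sigma_finite "\<lambda>_::nat. lborel :: real measure" ..
  show ?thesis unfolding leb_def by (rule sigma_finite) fact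
qed

lemma measurable_component_leb [measurable (raw)]:
  assumes "i \<in> I" "f \<in> M \<rightarrow>\<^sub>M leb I"
  shows "(\<lambda>x. f x i) \<in> borel_measurable M"
  using measurable_compose[OF assms(2)[unfolded leb_def] measurable_component_singleton[OF assms(1)]] by simp

section \<open>Outer approximation by open subsets of R^I\<close>

definition open_cube :: "nat set \<Rightarrow> real \<Rightarrow> (nat \<Rightarrow> real) set" where
  "open_cube I R = {u \<in> space (leb I). \<forall>i\<in>I. \<bar>u i\<bar> < R}"

text \<open>Openness in R^I for the maximum norm. It is written out because the points of
  \<open>leb I\<close> are functions frozen to \<open>undefined\<close> off \<open>I\<close>, so
  such a set need not be open in the space of all functions.\<close>

definition locally_cubic :: "nat set \<Rightarrow> (nat \<Rightarrow> real) set \<Rightarrow> bool" where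
  "locally_cubic I V \<longleftrightarrow>
     (\<forall>u\<in>V. \<exists>\<delta>>0. \<forall>v\<in>space (leb I). (\<forall>i\<in>I. \<bar>u i - v i\<bar> < \<delta>) \<longrightarrow> v \<in> V)"

lemma open_cube_sets [measurable]:
  assumes "finite I"
  shows "open_cube I R \<in> sets (leb I)"
  unfolding open_cube_def using assms by measurable

lemma emeasure_open_cube:
  assumes "finite I" "R > 0"
  shows "emeasure (leb I) (open_cube I R) < \<infinity>"
proof -
  interpret product_sigma_finite "\<lambda>_::nat. lborel :: real measure" ..
  have "open_cube I R = (\<Pi>\<^sub>E i\<in>I. {-R<..<R})"
  proof -
    have "\<bar>r\<bar> < R \<longleftrightarrow> r \<in> {-R<..<R}" for r by auto
    then show ?thesis
      unfolding open_cube_def space_leb by (auto simp only: PiE_def Pi_def)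
  qed
  then have "emeasure (leb I) (open_cube I R) = (\<Prod>i\<in>I. emeasure lborel {-R<..<R})"
    using assms(1) by (simp add: leb_def emeasure_PiM)
  then show ?thesis
    using assms by (simp add: ennreal_power flip: ennreal_numeral)
qed

text \<open>Outer regularity of finite Borel measures on the full function space is applied to the
  image of Lebesgue measure on the cube. An open superset is cut back to the cube; the result is
  open in R^I since basic open sets are boxes and \<open>I\<close> is finite.\<close>

lemma cubic_outer_approximation:
  assumes I: "finite I" and A: "A \<in> sets (leb I)" "A \<subseteq> open_cube I R" and R: "R > 0" and e: "e > 0"
  obtains V where "V \<in> sets (leb I)" "A \<subseteq> V" "locally_cubic I V" "emeasure (leb I) (V - A) \<le> ennreal e"
proof -
  let ?B = "open_cube I R"
  have id: "(\<lambda>x. x) \<in> leb I \<rightarrow>\<^sub>M (borel :: (nat \<Rightarrow> real) measure)"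
  proof -
    have "(\<lambda>x i. if i \<in> I then x i else undefined) \<in> leb I \<rightarrow>\<^sub>M Pi\<^sub>M UNIV (\<lambda>_. borel)"
    proof (rule measurable_PiM_single')
      show "(\<lambda>x. if i \<in> I then x i else undefined) \<in> leb I \<rightarrow>\<^sub>M borel" for i
        by (cases "i \<in> I") auto
    qed auto
    then have "(\<lambda>x. x) \<in> leb I \<rightarrow>\<^sub>M Pi\<^sub>M UNIV (\<lambda>_. borel)"
      by (rule measurable_cong[THEN iffD1, rotated]) (auto simp: space_leb PiE_iff extensional_def)
    then show ?thesis
      using measurable_cong_sets[OF refl[of "sets (leb I)"] sets_PiM_equal_borel[where 'a=nat and 'b=real]]
      by (simp only:)
  qed
  have restrict: "(\<lambda>x. restrict x I) \<in> borel \<rightarrow>\<^sub>M leb I"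
  proof -
    have "(\<lambda>x. restrict x I) \<in> Pi\<^sub>M UNIV (\<lambda>_. lborel) \<rightarrow>\<^sub>M leb I"
      unfolding leb_def by (rule measurable_restrict_subset) simp
    moreover have sets_eq: "sets (Pi\<^sub>M UNIV (\<lambda>_::nat. lborel :: real measure)) = sets borel"
      by (subst sets_PiM_equal_borel[symmetric]) (intro sets_PiM_cong, auto)
    ultimately show ?thesis
      using measurable_cong_sets[OF sets_eq refl[of "sets (leb I)"]] by (simp only:)
  qed
  \<comment> \<open>Restriction to the cube makes the measure finite, as outer regularity demands;
    the identity map carries it to the full function space.\<close>
  let ?\<rho> = "distr (density (leb I) (indicator ?B)) borel (\<lambda>x. x)"
  have id': "(\<lambda>x. x) \<in> density (leb I) (indicator ?B) \<rightarrow>\<^sub>M borel" using id by simp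
  have em: "emeasure ?\<rho> S = emeasure (leb I) (S \<inter> space (leb I) \<inter> ?B)" if "S \<in> sets borel" for S
  proof -
    have S: "S \<inter> space (leb I) \<in> sets (leb I)"
      using measurable_sets[OF id that] by (simp add: vimage_def Int_def)
    then have "emeasure (density (leb I) (indicator ?B)) (S \<inter> space (leb I)) = emeasure (leb I) (S \<inter> space (leb I) \<inter> ?B)"
      using I by (subst emeasure_density) (auto simp flip: indicator_inter_arith simp: Int_commute)
    then show ?thesis
      using that id' by (simp add: emeasure_distr vimage_def Int_def)
  qed
  \<comment> \<open>The cylinder over \<open>A\<close> is Borel in the full function space, being a
    preimage under restriction, and it meets the space of \<open>leb I\<close> exactly in
    \<open>A\<close>.\<close>
  define A' where "A' = (\<lambda>x. restrict x I) -` A"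
  have A': "A' \<in> sets borel" using measurable_sets[OF restrict A(1)] by (simp add: A'_def)
  have A'A: "A' \<inter> space (leb I) = A"
    using sets.sets_into_space[OF A(1)] by (auto simp: A'_def space_leb PiE_restrict)
  have fin: "emeasure (leb I) A < \<infinity>"
    using emeasure_open_cube[OF I R] emeasure_mono[OF A(2) open_cube_sets[OF I]] by (rule le_less_trans[rotated])
  have "emeasure ?\<rho> A' = emeasure (leb I) A"
    using A(2) by (simp add: em[OF A'] A'A Int_absorb2)
  moreover have "emeasure ?\<rho> A' = (INF U \<in> {U. A' \<subseteq> U \<and> open U}. emeasure ?\<rho> U)"
  proof (rule outer_regular)
    have "emeasure ?\<rho> UNIV = emeasure (leb I) (space (leb I) \<inter> ?B)"
      by (subst em) auto
    also have "\<dots> \<le> emeasure (leb I) ?B" using I by (intro emeasure_mono) auto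
    finally show "emeasure ?\<rho> (space ?\<rho>) \<noteq> \<infinity>" using emeasure_open_cube[OF I R] by (auto simp: top_unique)
  qed (use A' in auto)
  moreover have "emeasure (leb I) A < emeasure (leb I) A + ennreal e"
    using fin e ennreal_add_left_cancel_less[of "emeasure (leb I) A" 0 "ennreal e"] by auto
  ultimately have "(INF U \<in> {U. A' \<subseteq> U \<and> open U}. emeasure ?\<rho> U) < emeasure (leb I) A + ennreal e"
    by simp
  then obtain U where U: "A' \<subseteq> U" "open U" "emeasure ?\<rho> U < emeasure (leb I) A + ennreal e"
    unfolding INF_less_iff by auto
  define V where "V = U \<inter> space (leb I) \<inter> ?B"
  have Us: "U \<in> sets borel" using U(2) by simp
  have Vs: "V \<in> sets (leb I)"
  proof -
    have "U \<inter> space (leb I) \<in> sets (leb I)"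
      using measurable_sets[OF id Us] by (simp add: vimage_def Int_def)
    from sets.Int[OF this open_cube_sets[OF I]] show ?thesis by (simp only: V_def)
  qed
  have AV: "A \<subseteq> V" using A(2) A'A U(1) by (auto simp: V_def)
  have "emeasure (leb I) V \<le> emeasure (leb I) A + ennreal e"
    using U(3) em[OF Us] by (simp add: V_def)
  then have "emeasure (leb I) (V - A) \<le> ennreal e"
    using fin AV Vs A(1) by (subst emeasure_Diff) (auto simp: ennreal_minus_le_iff)
  moreover have "locally_cubic I V"
    unfolding locally_cubic_def
  proof
    fix u assume u: "u \<in> V"
    have "openin (product_topology (\<lambda>_. euclidean) UNIV) U" using U(2) by (simp add: open_fun_def)
    from product_topology_open_contains_basis[OF this, of u] u obtain X
      where X: "u \<in> (\<Pi>\<^sub>E i\<in>UNIV. X i)" "\<And>i. open (X i)" "(\<Pi>\<^sub>E i\<in>UNIV. X i) \<subseteq> U"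
      by (auto simp: V_def)
    have "\<forall>\<^sub>F \<delta> in at_right 0. \<forall>i\<in>I. ball (u i) \<delta> \<subseteq> X i \<inter> {-R<..<R}"
    proof (rule eventually_ball_finite[OF I], intro ballI)
      fix i assume i: "i \<in> I"
      have "open (X i \<inter> {-R<..<R})" "u i \<in> X i \<inter> {-R<..<R}"
        using X(1,2) u i by (auto simp: V_def open_cube_def abs_less_iff)
      then obtain d where d: "d > 0" "ball (u i) d \<subseteq> X i \<inter> {-R<..<R}"
        by (meson open_contains_ball)
      then show "\<forall>\<^sub>F \<delta> in at_right 0. ball (u i) \<delta> \<subseteq> X i \<inter> {-R<..<R}"
        unfolding eventually_at_right_field by (intro exI[of _ d]) (auto simp: subset_eq)
    qed
    then have "\<forall>\<^sub>F \<delta> in at_right 0. 0 < \<delta> \<and> (\<forall>i\<in>I. ball (u i) \<delta> \<subseteq> X i \<inter> {-R<..<R})"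
      using eventually_at_right_less[of "0::real"] by eventually_elim auto
    then obtain \<delta> where \<delta>: "\<delta> > 0" "\<forall>i\<in>I. ball (u i) \<delta> \<subseteq> X i \<inter> {-R<..<R}"
      by (metis (mono_tags, lifting) eventually_happens' trivial_limit_at_right_real)
    show "\<exists>\<delta>>0. \<forall>v\<in>space (leb I). (\<forall>i\<in>I. \<bar>u i - v i\<bar> < \<delta>) \<longrightarrow> v \<in> V"
    proof (intro exI conjI ballI impI)
      fix v assume v: "v \<in> space (leb I)" "\<forall>i\<in>I. \<bar>u i - v i\<bar> < \<delta>"
      have in_ball: "v i \<in> X i \<inter> {-R<..<R}" if "i \<in> I" for i
      proof -
        have "v i \<in> ball (u i) \<delta>" using v(2) that by (simp add: dist_real_def)
        then show ?thesis using \<delta>(2) that by blast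
      qed
      \<comment> \<open>Off \<open>I\<close> both points take the value \<open>undefined\<close>, so
        the sides of the box outside \<open>I\<close> already contain v.\<close>
      have "v i = u i" if "i \<notin> I" for i
        using u v(1) that by (auto simp: V_def space_leb PiE_iff extensional_def)
      then have "v \<in> (\<Pi>\<^sub>E i\<in>UNIV. X i)"
        using X(1) in_ball by (auto simp: PiE_iff) (metis IntE)
      moreover have "\<bar>v i\<bar> < R" if "i \<in> I" for i
        using in_ball[OF that] by auto
      ultimately show "v \<in> V"
        using X(3) v(1) by (auto simp: V_def open_cube_def)
    qed fact
  qed
  ultimately show thesis using that[of V] Vs AV by blast
qed

section \<open>Mollification by small cubes\<close>

definition cube_kernel :: "nat set \<Rightarrow> real \<Rightarrow> real \<Rightarrow> (nat \<Rightarrow> real) \<Rightarrow> (nat \<Rightarrow> real) \<Rightarrow> ennreal" where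
  "cube_kernel I c h u v = (\<Prod>i\<in>I. ennreal c * indicator {..<h} \<bar>u i - v i\<bar>)"

lemma cube_kernel_measurable [measurable (raw)]:
  assumes [measurable]: "f \<in> M \<rightarrow>\<^sub>M leb I" "g \<in> M \<rightarrow>\<^sub>M leb I"
  shows "(\<lambda>x. cube_kernel I c h (f x) (g x)) \<in> borel_measurable M"
  unfolding cube_kernel_def by measurable

lemma cube_kernel_measurable_right [measurable]: "cube_kernel I c h u \<in> borel_measurable (leb I)"
  unfolding cube_kernel_def[abs_def] by measurable

lemma cube_kernel_eq:
  assumes "finite I"
  shows "cube_kernel I c h u v = ennreal c ^ card I * (if \<forall>i\<in>I. \<bar>u i - v i\<bar> < h then 1 else 0)"
  using assms by (auto simp: cube_kernel_def prod.distrib indicator_def prod_eq_1_iff)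

text \<open>Radius h/2 and height 1/h per coordinate give the uniform probability density on a cube
  of side h. Radius and height are separate parameters because the kernel of the energy has the same
  height but radius h.\<close>

lemma integral_cube_kernel:
  assumes "finite I" "h > 0"
  shows "(\<integral>\<^sup>+v. cube_kernel I (1 / h) (h / 2) u v \<partial>leb I) = 1"
proof -
  interpret product_sigma_finite "\<lambda>_::nat. lborel :: real measure" ..
  have "(\<integral>\<^sup>+x. ennreal (1 / h) * indicator {..<h/2} \<bar>a - x\<bar> \<partial>lborel) = 1" for a
  proof -
    have eq: "ennreal (1 / h) * indicator {..<h/2} \<bar>a - x\<bar> = ennreal (1 / h) * indicator {a-h/2<..<a+h/2} x" for x
    proof -
      have "\<bar>a - x\<bar> < h / 2 \<longleftrightarrow> a - h / 2 < x \<and> x < a + h / 2" by arith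
      then show ?thesis by (simp add: indicator_def)
    qed
    show ?thesis
      unfolding eq using assms by (simp add: nn_integral_cmult_indicator flip: ennreal_mult)
  qed
  then show ?thesis
    unfolding cube_kernel_def leb_def using assms(1)
    by (subst product_nn_integral_prod) auto
qed

text \<open>Two cubes of radius h/2 meet only if their centres differ by less than h in every
  coordinate; then one factor is bounded by its height and the other integrates to 1.\<close>

lemma integral_cube_kernel_mult:
  assumes "finite I" "h > 0"
  shows "(\<integral>\<^sup>+v. cube_kernel I (1 / h) (h / 2) u v * cube_kernel I (1 / h) (h / 2) u' v \<partial>leb I)
     \<le> cube_kernel I (1 / h) h u u'"
proof -
  have "(\<integral>\<^sup>+v. cube_kernel I (1 / h) (h / 2) u v * cube_kernel I (1 / h) (h / 2) u' v \<partial>leb I)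
    \<le> (\<integral>\<^sup>+v. cube_kernel I (1 / h) h u u' * cube_kernel I (1 / h) (h / 2) u v \<partial>leb I)"
  proof (rule nn_integral_mono)
    fix v
    have *: "\<bar>u i - u' i\<bar> < h" if "\<bar>u i - v i\<bar> < h/2" "\<bar>u' i - v i\<bar> < h/2" for i
      using that by arith
    show "cube_kernel I (1 / h) (h / 2) u v * cube_kernel I (1 / h) (h / 2) u' v
       \<le> cube_kernel I (1 / h) h u u' * cube_kernel I (1 / h) (h / 2) u v"
      unfolding cube_kernel_eq[OF assms(1)] using * by (auto simp: mult_ac)
  qed
  also have "\<dots> = cube_kernel I (1 / h) h u u'"
    by (subst nn_integral_cmult) (simp_all add: integral_cube_kernel[OF assms])
  finally show ?thesis .
qed

lemma ennreal_liminf_square_le: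
  fixes a :: "nat \<Rightarrow> ennreal"
  assumes "\<And>n. (a n)\<^sup>2 \<le> X"
  shows "(liminf a)\<^sup>2 \<le> X"
proof (cases X)
  case (real x)
  have "a n \<le> ennreal (sqrt x)" for n
  proof (cases "a n")
    case (real y)
    have "y\<^sup>2 \<le> x"
      using assms[of n] real \<open>X = ennreal x\<close> \<open>0 \<le> x\<close> by (simp add: ennreal_power)
    then show ?thesis using real by (simp add: real_le_rsqrt ennreal_leI)
  next
    case top
    then show ?thesis using assms[of n] \<open>X = ennreal x\<close> by (simp add: power2_eq_square top_unique)
  qed
  then have "liminf a \<le> ennreal (sqrt x)"
    by (intro Liminf_le) auto
  then have "(liminf a)\<^sup>2 \<le> (ennreal (sqrt x))\<^sup>2"
    by (intro power_mono) auto
  then show ?thesis using real by (simp add: ennreal_power)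
qed simp

text \<open>The mollification \<open>f n\<close> of \<tau> has squared L^2 norm at most the energy
  at scale \<open>\<epsilon> n\<close>, hence at most C. As a combination of indicators of open
  sets, h is lower semicontinuous, so it lies below the lower limit of its own mollifications. Fatou
  for \<tau> and Cauchy-Schwarz against \<open>f n\<close> conclude. Openness makes this work before
  \<tau> is known to be absolutely continuous.\<close>

lemma pushforward_L2_bound_locally_cubic:
  fixes c :: "'t \<Rightarrow> ennreal" and V :: "'t \<Rightarrow> (nat \<Rightarrow> real) set"
  assumes I: "finite I" and \<tau>: "sets \<tau> = sets (leb I)" "finite_measure \<tau>"
    and \<epsilon>: "\<And>n::nat. \<epsilon> n > 0" "\<epsilon> \<longlonglongrightarrow> 0"
    and energy: "\<And>n. (\<integral>\<^sup>+u. \<integral>\<^sup>+v. cube_kernel I (1 / \<epsilon> n) (\<epsilon> n) u v \<partial>\<tau> \<partial>\<tau>) \<le> C"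
    and T: "finite T" "\<And>t. t \<in> T \<Longrightarrow> V t \<in> sets (leb I)" "\<And>t. t \<in> T \<Longrightarrow> locally_cubic I (V t)"
  defines "h \<equiv> \<lambda>u. \<Sum>t\<in>T. c t * indicator (V t) u"
  shows "(\<integral>\<^sup>+u. h u \<partial>\<tau>)\<^sup>2 \<le> C * (\<integral>\<^sup>+u. (h u)\<^sup>2 \<partial>leb I)"
proof -
  note [measurable_cong] = \<tau>(1)
  interpret \<tau>: finite_measure \<tau> by fact
  interpret L: sigma_finite_measure "leb I" by (rule sigma_finite_leb[OF I])
  interpret pair_sigma_finite \<tau> "leb I" ..
  have [measurable]: "h \<in> borel_measurable (leb I)"
    unfolding h_def using T by measurable
  define k where "k n = cube_kernel I (1 / \<epsilon> n) (\<epsilon> n / 2)" for n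
  have k_meas [measurable (raw)]: "(\<lambda>x. k n (f x) (g x)) \<in> borel_measurable M"
    if "f \<in> M \<rightarrow>\<^sub>M leb I" "g \<in> M \<rightarrow>\<^sub>M leb I" for f g M n
    unfolding k_def using that by measurable
  have [measurable]: "k n u \<in> borel_measurable (leb I)" for n u
    unfolding k_def by measurable
  define f where "f n v = (\<integral>\<^sup>+u. k n u v \<partial>\<tau>)" for n v
  have [measurable]: "f n \<in> borel_measurable (leb I)" for n
    unfolding f_def[abs_def] by measurable
  have f_sq: "(\<integral>\<^sup>+v. (f n v)\<^sup>2 \<partial>leb I) \<le> C" for n
  proof -
    have "(f n v)\<^sup>2 = (\<integral>\<^sup>+u. \<integral>\<^sup>+u'. k n u v * k n u' v \<partial>\<tau> \<partial>\<tau>)" if "v \<in> space (leb I)" for v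
      using that by (simp add: f_def power2_eq_square nn_integral_cmult nn_integral_multc)
    then have "(\<integral>\<^sup>+v. (f n v)\<^sup>2 \<partial>leb I) = (\<integral>\<^sup>+v. \<integral>\<^sup>+u. \<integral>\<^sup>+u'. k n u v * k n u' v \<partial>\<tau> \<partial>\<tau> \<partial>leb I)"
      by (intro nn_integral_cong)
    also have "\<dots> = (\<integral>\<^sup>+u. \<integral>\<^sup>+v. \<integral>\<^sup>+u'. k n u v * k n u' v \<partial>\<tau> \<partial>leb I \<partial>\<tau>)"
      by (rule Fubini') measurable
    also have "\<dots> = (\<integral>\<^sup>+u. \<integral>\<^sup>+u'. \<integral>\<^sup>+v. k n u v * k n u' v \<partial>leb I \<partial>\<tau> \<partial>\<tau>)"
      by (intro nn_integral_cong Fubini') measurable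
    also have "\<dots> \<le> (\<integral>\<^sup>+u. \<integral>\<^sup>+u'. cube_kernel I (1 / \<epsilon> n) (\<epsilon> n) u u' \<partial>\<tau> \<partial>\<tau>)"
      unfolding k_def by (intro nn_integral_mono integral_cube_kernel_mult I \<epsilon>)
    also have "\<dots> \<le> C" by (rule energy)
    finally show ?thesis .
  qed
  have fatou: "h u \<le> liminf (\<lambda>n. \<integral>\<^sup>+v. k n u v * h v \<partial>leb I)" if u: "u \<in> space (leb I)" for u
  proof -
    \<comment> \<open>Only the sets containing u contribute to h u. They still contain every v near
      u, and the remaining sets can only increase h v.\<close>
    define T' where "T' = {t \<in> T. u \<in> V t}"
    have "\<exists>\<delta>>0. \<forall>v\<in>space (leb I). (\<forall>i\<in>I. \<bar>u i - v i\<bar> < \<delta>) \<longrightarrow> v \<in> V t" if "t \<in> T'" for t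
      using T(3) that unfolding locally_cubic_def T'_def by blast
    then obtain d where d: "\<And>t. t \<in> T' \<Longrightarrow> d t > 0"
       "\<And>t v. \<lbrakk>t \<in> T'; v \<in> space (leb I); \<forall>i\<in>I. \<bar>u i - v i\<bar> < d t\<rbrakk> \<Longrightarrow> v \<in> V t"
      by metis
    \<comment> \<open>The element 1 keeps the minimum meaningful when no set contains u.\<close>
    define \<delta> where "\<delta> = Min (insert 1 (d ` T'))"
    have fin: "finite (insert 1 (d ` T'))" using T(1) by (simp add: T'_def)
    have \<delta>: "\<delta> > 0" "\<And>t. t \<in> T' \<Longrightarrow> \<delta> \<le> d t"
      unfolding \<delta>_def using fin d(1) by auto
    have "\<forall>\<^sub>F n in sequentially. \<epsilon> n < \<delta>"
      using order_tendstoD(2)[OF \<epsilon>(2) \<delta>(1)] .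
    then have "\<forall>\<^sub>F n in sequentially. h u \<le> (\<integral>\<^sup>+v. k n u v * h v \<partial>leb I)"
    proof eventually_elim
      case (elim n)
      have "h u = (\<integral>\<^sup>+v. k n u v * h u \<partial>leb I)"
        using integral_cube_kernel[OF I \<epsilon>(1), of n u] by (simp add: nn_integral_multc k_def)
      also have "\<dots> \<le> (\<integral>\<^sup>+v. k n u v * h v \<partial>leb I)"
      proof (rule nn_integral_mono)
        fix v assume v: "v \<in> space (leb I)"
        show "k n u v * h u \<le> k n u v * h v"
        proof (cases "\<forall>i\<in>I. \<bar>u i - v i\<bar> < \<epsilon> n / 2")
          case True
          have "v \<in> V t" if "t \<in> T'" for t
          proof (rule d(2)[OF that v], intro ballI)
            fix i assume "i \<in> I"
            then have "\<bar>u i - v i\<bar> < \<epsilon> n / 2" using True by blast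
            then show "\<bar>u i - v i\<bar> < d t" using elim \<delta>(2)[OF that] \<epsilon>(1)[of n] by linarith
          qed
          then have "h u \<le> h v"
            unfolding h_def by (intro sum_mono mult_left_mono) (auto simp: indicator_def T'_def)
          then show ?thesis by (intro mult_left_mono) auto
        next
          case False
          then have "k n u v = 0"
            by (simp only: k_def cube_kernel_eq[OF I] if_False mult_zero_right)
          then show ?thesis by simp
        qed
      qed
      finally show ?case .
    qed
    then show ?thesis by (intro Liminf_bounded) auto
  qed
  have "(\<integral>\<^sup>+u. h u \<partial>\<tau>) \<le> (\<integral>\<^sup>+u. liminf (\<lambda>n. \<integral>\<^sup>+v. k n u v * h v \<partial>leb I) \<partial>\<tau>)"
    using sets_eq_imp_space_eq[OF \<tau>(1)] by (intro nn_integral_mono fatou) simp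
  also have "\<dots> \<le> liminf (\<lambda>n. \<integral>\<^sup>+u. \<integral>\<^sup>+v. k n u v * h v \<partial>leb I \<partial>\<tau>)"
    by (rule nn_integral_liminf) measurable
  also have "(\<lambda>n. \<integral>\<^sup>+u. \<integral>\<^sup>+v. k n u v * h v \<partial>leb I \<partial>\<tau>) = (\<lambda>n. \<integral>\<^sup>+v. f n v * h v \<partial>leb I)"
  proof
    fix n
    have "(\<integral>\<^sup>+u. \<integral>\<^sup>+v. k n u v * h v \<partial>leb I \<partial>\<tau>) = (\<integral>\<^sup>+v. \<integral>\<^sup>+u. k n u v * h v \<partial>\<tau> \<partial>leb I)"
      by (rule Fubini'[symmetric]) measurable
    also have "\<dots> = (\<integral>\<^sup>+v. f n v * h v \<partial>leb I)"
      unfolding f_def by (intro nn_integral_cong nn_integral_multc) measurable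
    finally show "(\<integral>\<^sup>+u. \<integral>\<^sup>+v. k n u v * h v \<partial>leb I \<partial>\<tau>) = (\<integral>\<^sup>+v. f n v * h v \<partial>leb I)" .
  qed
  finally have "(\<integral>\<^sup>+u. h u \<partial>\<tau>)\<^sup>2 \<le> (liminf (\<lambda>n. \<integral>\<^sup>+v. f n v * h v \<partial>leb I))\<^sup>2"
    by (intro power_mono) auto
  also have "\<dots> \<le> C * (\<integral>\<^sup>+u. (h u)\<^sup>2 \<partial>leb I)"
  proof (rule ennreal_liminf_square_le)
    fix n
    have "(\<integral>\<^sup>+v. f n v * h v \<partial>leb I)\<^sup>2 \<le> (\<integral>\<^sup>+v. (f n v)\<^sup>2 \<partial>leb I) * (\<integral>\<^sup>+v. (h v)\<^sup>2 \<partial>leb I)"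
      by (rule Cauchy_Schwarz_nn_integral) measurable
    also have "\<dots> \<le> C * (\<integral>\<^sup>+v. (h v)\<^sup>2 \<partial>leb I)"
      by (intro mult_right_mono f_sq) simp
    finally show "(\<integral>\<^sup>+v. f n v * h v \<partial>leb I)\<^sup>2 \<le> C * (\<integral>\<^sup>+v. (h v)\<^sup>2 \<partial>leb I)" .
  qed
  finally show ?thesis .
qed

text \<open>Each \<open>A t\<close> is enclosed in an open set with excess measure at most e. Since
  h and its majorant \<open>h'\<close> are bounded by the sum S of the coefficients, and the
  difference g has integral at most S e, the integral of the square grows by at most 2 S^2 e; then e
  tends to 0.\<close>

lemma pushforward_L2_bound_simple:
  fixes c :: "'t \<Rightarrow> ennreal" and A :: "'t \<Rightarrow> (nat \<Rightarrow> real) set"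
  assumes I: "finite I" and \<tau>: "sets \<tau> = sets (leb I)" "finite_measure \<tau>"
    and \<epsilon>: "\<And>n::nat. \<epsilon> n > 0" "\<epsilon> \<longlonglongrightarrow> 0"
    and energy: "\<And>n. (\<integral>\<^sup>+u. \<integral>\<^sup>+v. cube_kernel I (1 / \<epsilon> n) (\<epsilon> n) u v \<partial>\<tau> \<partial>\<tau>) \<le> C"
    and C: "C < \<infinity>"
    and T: "finite T" "\<And>t. t \<in> T \<Longrightarrow> A t \<in> sets (leb I)" "\<And>t. t \<in> T \<Longrightarrow> A t \<subseteq> open_cube I R"
    and R: "R > 0" and c: "\<And>t. t \<in> T \<Longrightarrow> c t < \<infinity>"
  defines "h \<equiv> \<lambda>u. \<Sum>t\<in>T. c t * indicator (A t) u"
  shows "(\<integral>\<^sup>+u. h u \<partial>\<tau>)\<^sup>2 \<le> C * (\<integral>\<^sup>+u. (h u)\<^sup>2 \<partial>leb I)"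
proof -
  note [measurable_cong] = \<tau>(1)
  interpret \<tau>: finite_measure \<tau> by fact
  define S where "S = (\<Sum>t\<in>T. c t)"
  have S: "S < \<infinity>" using c T(1) by (simp add: S_def)
  define X where "X = (\<integral>\<^sup>+u. (h u)\<^sup>2 \<partial>leb I)"
  have main: "(\<integral>\<^sup>+u. h u \<partial>\<tau>)\<^sup>2 \<le> C * X + (2 * C * S\<^sup>2) * ennreal e" if e: "e > 0" for e
  proof -
    have "\<forall>t\<in>T. \<exists>V. V \<in> sets (leb I) \<and> A t \<subseteq> V \<and> locally_cubic I V \<and> emeasure (leb I) (V - A t) \<le> ennreal e"
      by (intro ballI, rule cubic_outer_approximation[OF I T(2) T(3) R e]) blast+
    from bchoice[OF this] obtain V where V: "\<And>t. t \<in> T \<Longrightarrow> V t \<in> sets (leb I)" "\<And>t. t \<in> T \<Longrightarrow> A t \<subseteq> V t"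
      "\<And>t. t \<in> T \<Longrightarrow> locally_cubic I (V t)" "\<And>t. t \<in> T \<Longrightarrow> emeasure (leb I) (V t - A t) \<le> ennreal e"
      by blast
    define h' where "h' u = (\<Sum>t\<in>T. c t * indicator (V t) u)" for u
    define g where "g u = (\<Sum>t\<in>T. c t * indicator (V t - A t) u)" for u
    have [measurable]: "h \<in> borel_measurable (leb I)" "g \<in> borel_measurable (leb I)"
      unfolding h_def g_def[abs_def] using T V by measurable
    have h'_eq: "h' u = h u + g u" for u
      unfolding h'_def h_def g_def sum.distrib[symmetric]
    proof (rule sum.cong)
      fix t assume t: "t \<in> T"
      have "indicator (V t) u = indicator (A t) u + (indicator (V t - A t) u :: ennreal)"
        using V(2)[OF t] by (auto simp: indicator_def)
      then show "c t * indicator (V t) u = c t * indicator (A t) u + c t * indicator (V t - A t) u"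
        by (simp add: distrib_left)
    qed simp
    have hS: "h u \<le> S" "h' u \<le> S" for u
      unfolding h_def h'_def S_def by (intro sum_mono; auto simp: indicator_def)+
    have sq: "(h' u)\<^sup>2 \<le> (h u)\<^sup>2 + 2 * S * g u" for u
    proof -
      have "(h' u)\<^sup>2 = (h u)\<^sup>2 + (h u + h' u) * g u"
        by (simp add: h'_eq power2_eq_square algebra_simps)
      also have "\<dots> \<le> (h u)\<^sup>2 + (S + S) * g u"
        by (intro add_left_mono mult_right_mono add_mono hS) simp
      finally show ?thesis by (simp add: mult_2 flip: mult.assoc)
    qed
    have "(\<integral>\<^sup>+u. g u \<partial>leb I) = (\<Sum>t\<in>T. c t * emeasure (leb I) (V t - A t))"
      unfolding g_def using T V by (subst nn_integral_sum) (auto simp: nn_integral_cmult_indicator)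
    also have "\<dots> \<le> (\<Sum>t\<in>T. c t * ennreal e)"
      using V(4) by (intro sum_mono mult_left_mono) auto
    also have "\<dots> = S * ennreal e" by (simp add: S_def sum_distrib_right)
    finally have g: "(\<integral>\<^sup>+u. g u \<partial>leb I) \<le> S * ennreal e" .
    have "(\<integral>\<^sup>+u. (h' u)\<^sup>2 \<partial>leb I) \<le> (\<integral>\<^sup>+u. (h u)\<^sup>2 + 2 * S * g u \<partial>leb I)"
      by (intro nn_integral_mono sq)
    also have "\<dots> = X + 2 * S * (\<integral>\<^sup>+u. g u \<partial>leb I)"
      by (simp add: nn_integral_add nn_integral_cmult X_def)
    also have "\<dots> \<le> X + 2 * S * (S * ennreal e)"
      by (intro add_left_mono mult_left_mono g) simp
    finally have h'_sq: "(\<integral>\<^sup>+u. (h' u)\<^sup>2 \<partial>leb I) \<le> X + 2 * S * (S * ennreal e)" .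
    have "(\<integral>\<^sup>+u. h u \<partial>\<tau>)\<^sup>2 \<le> (\<integral>\<^sup>+u. h' u \<partial>\<tau>)\<^sup>2"
      by (intro power_mono nn_integral_mono) (auto simp: h'_eq)
    also have "\<dots> \<le> C * (\<integral>\<^sup>+u. (h' u)\<^sup>2 \<partial>leb I)"
      unfolding h'_def by (rule pushforward_L2_bound_locally_cubic[OF I \<tau> \<epsilon> energy T(1) V(1,3)])
    also have "\<dots> \<le> C * (X + 2 * S * (S * ennreal e))"
      by (intro mult_left_mono h'_sq) simp
    finally show ?thesis by (simp add: power2_eq_square distrib_left mult_ac)
  qed
  define B where "B = 2 * C * S\<^sup>2"
  have "B < \<infinity>" using C S by (simp add: B_def ennreal_mult_less_top power2_eq_square)
  then obtain b where b: "b \<ge> 0" "B = ennreal b" by (cases B) auto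
  show ?thesis
    unfolding X_def[symmetric]
  proof (rule ennreal_le_epsilon)
    fix e :: real assume e: "e > 0"
    \<comment> \<open>The denominator b + 1 keeps the error below e, also when b = 0.\<close>
    have "(\<integral>\<^sup>+u. h u \<partial>\<tau>)\<^sup>2 \<le> C * X + B * ennreal (e / (b + 1))"
      using main[of "e / (b + 1)"] e b by (simp add: B_def)
    also have "B * ennreal (e / (b + 1)) \<le> ennreal e"
      using b e by (simp add: ennreal_mult[symmetric] field_simps)
    finally show "(\<integral>\<^sup>+u. h u \<partial>\<tau>)\<^sup>2 \<le> C * X + ennreal e" by (simp add: add_left_mono)
  qed
qed

lemma ennreal_square_le_imp_le:
  fixes a C :: ennreal
  assumes "a\<^sup>2 \<le> C * a" "a < \<infinity>"
  shows "a \<le> C"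
proof (cases "a = 0")
  case False
  then show ?thesis
    using assms ennreal_mult_le_mult_iff[of a a C] by (simp add: power2_eq_square mult.commute)
qed simp

text \<open>By duality. Testing with indicators of null sets gives absolute continuity and hence a
  density f. For a simple function h below f, the integral of h^2 is at most that of f h, which is
  the \<tau>-integral of h, and the square of the latter is at most C times the integral of h^2.
  Cancelling gives the bound C for every such h, and Fatou passes it to f.\<close>

lemma in_L2_if_energy_bounded:
  assumes I: "finite I" and \<tau>: "sets \<tau> = sets (leb I)" "finite_measure \<tau>"
    and \<epsilon>: "\<And>n::nat. \<epsilon> n > 0" "\<epsilon> \<longlonglongrightarrow> 0"
    and energy: "\<And>n. (\<integral>\<^sup>+u. \<integral>\<^sup>+v. cube_kernel I (1 / \<epsilon> n) (\<epsilon> n) u v \<partial>\<tau> \<partial>\<tau>) \<le> C"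
    and C: "C < \<infinity>"
  shows "in_L2 I \<tau>"
proof -
  note [measurable_cong] = \<tau>(1)
  interpret \<tau>: finite_measure \<tau> by fact
  interpret L: sigma_finite_measure "leb I" by (rule sigma_finite_leb[OF I])
  note bound = pushforward_L2_bound_simple[OF I \<tau> \<epsilon> energy C]
  \<comment> \<open>Exhaustion by cubes supplies the bounded supports on which the outer
    approximation is available.\<close>
  define B where "B n = open_cube I (real n + 1)" for n :: nat
  have B_meas [measurable]: "B n \<in> sets (leb I)" for n using I by (simp add: B_def)
  have B_ev: "\<forall>\<^sub>F n in sequentially. u \<in> B n" if u: "u \<in> space (leb I)" for u
  proof -
    have "\<forall>\<^sub>F n in sequentially. \<bar>u i\<bar> < real n + 1" for i
      by real_asymp
    then have "\<forall>\<^sub>F n in sequentially. \<forall>i\<in>I. \<bar>u i\<bar> < real n + 1"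
      using I by (intro eventually_ball_finite) auto
    then show ?thesis by eventually_elim (use u in \<open>auto simp: B_def open_cube_def\<close>)
  qed
  have "absolutely_continuous (leb I) \<tau>"
    unfolding absolutely_continuous_def
  proof
    fix A assume A: "A \<in> null_sets (leb I)"
    then have As: "A \<in> sets (leb I)" by auto
    have "A \<inter> B n \<in> null_sets \<tau>" for n
    proof -
      have "(\<integral>\<^sup>+u. (\<Sum>t\<in>{()}. 1 * indicator (A \<inter> B n) u) \<partial>\<tau>)\<^sup>2 \<le>
          C * (\<integral>\<^sup>+u. (\<Sum>t\<in>{()}. 1 * indicator (A \<inter> B n) u)\<^sup>2 \<partial>leb I)"
        by (rule bound[where R="real n + 1"]) (use As in \<open>auto simp: B_def I\<close>)
      moreover have "(\<integral>\<^sup>+u. (indicator (A \<inter> B n) u)\<^sup>2 \<partial>leb I) = (\<integral>\<^sup>+u. indicator (A \<inter> B n) u \<partial>leb I)"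
        by (intro nn_integral_cong) (simp add: indicator_def)
      moreover have "emeasure (leb I) (A \<inter> B n) = 0"
        using null_setsD1[OF A] by (rule emeasure_eq_0[OF As]) simp
      ultimately show ?thesis using As by (auto simp: null_sets_def \<tau>(1))
    qed
    then have "(\<Union>n. A \<inter> B n) \<in> null_sets \<tau>" by (rule null_sets_UN)
    moreover have "(\<Union>n. A \<inter> B n) = A"
    proof -
      have "\<exists>n. u \<in> B n" if "u \<in> A" for u
        using eventually_happens'[OF sequentially_bot B_ev] sets.sets_into_space[OF As] that by blast
      then show ?thesis by blast
    qed
    ultimately show "A \<in> null_sets \<tau>" by simp
  qed
  from L.Radon_Nikodym[OF this \<tau>(1)] obtain f
    where f [measurable]: "f \<in> borel_measurable (leb I)" and f_density: "density (leb I) f = \<tau>" by blast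
  obtain g where g: "\<And>i. simple_function (leb I) (g i)" "incseq g" "\<And>i x. g i x < top" "\<And>x. (SUP i. g i x) = f x"
  proof (rule borel_measurable_implies_simple_function_sequence'[OF f])
    fix g' assume "\<And>i. simple_function (leb I) (g' i)" "incseq g'" "\<And>i x. g' i x < top" "\<And>x. (SUP i. g' i x) = f x"
    then show thesis by (rule that)
  qed
  note [measurable] = borel_measurable_simple_function[OF g(1)]
  define h where "h n u = g n u * indicator (B n) u" for n u
  have h_sq: "(\<integral>\<^sup>+u. (h n u)\<^sup>2 \<partial>leb I) \<le> C" for n
  proof -
    let ?Y = "g n ` space (leb I)" and ?A = "\<lambda>y. g n -` {y} \<inter> space (leb I) \<inter> B n"
    have h_eq: "h n u = (\<Sum>y\<in>?Y. y * indicator (?A y) u)" if "u \<in> space (leb I)" for u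
    proof -
      have "h n u = (\<Sum>y\<in>?Y. y * indicator (g n -` {y} \<inter> space (leb I)) u) * indicator (B n) u"
        unfolding h_def by (rule arg_cong[OF simple_function_indicator_representation[OF g(1) that], of "\<lambda>x. x * indicator (B n) u"])
      also have "\<dots> = (\<Sum>y\<in>?Y. y * indicator (?A y) u)"
        by (simp add: sum_distrib_right indicator_inter_arith mult.assoc)
      finally show ?thesis .
    qed
    have finY: "finite ?Y" using simple_functionD(1)[OF g(1)] .
    have "(\<integral>\<^sup>+u. (\<Sum>y\<in>?Y. y * indicator (?A y) u) \<partial>\<tau>)\<^sup>2 \<le>
        C * (\<integral>\<^sup>+u. (\<Sum>y\<in>?Y. y * indicator (?A y) u)\<^sup>2 \<partial>leb I)"
      by (rule bound[where R="real n + 1"])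
         (use finY simple_functionD(2)[OF g(1)] g(3) in \<open>auto simp: B_def I\<close>)
    moreover have "(\<integral>\<^sup>+u. h n u \<partial>\<tau>) = (\<integral>\<^sup>+u. (\<Sum>y\<in>?Y. y * indicator (?A y) u) \<partial>\<tau>)"
      by (rule nn_integral_cong) (simp only: sets_eq_imp_space_eq[OF \<tau>(1)] h_eq)
    moreover have "(\<integral>\<^sup>+u. (h n u)\<^sup>2 \<partial>leb I) = (\<integral>\<^sup>+u. (\<Sum>y\<in>?Y. y * indicator (?A y) u)\<^sup>2 \<partial>leb I)"
      by (rule nn_integral_cong) (simp only: h_eq)
    ultimately have CS: "(\<integral>\<^sup>+u. h n u \<partial>\<tau>)\<^sup>2 \<le> C * (\<integral>\<^sup>+u. (h n u)\<^sup>2 \<partial>leb I)"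
      by (simp only:)
    have [measurable]: "h n \<in> borel_measurable (leb I)" unfolding h_def[abs_def] by measurable
    have "(\<integral>\<^sup>+u. (h n u)\<^sup>2 \<partial>leb I) \<le> (\<integral>\<^sup>+u. f u * h n u \<partial>leb I)"
    proof (rule nn_integral_mono)
      fix u
      have "g n u \<le> f u" unfolding g(4)[symmetric] by (rule SUP_upper) simp
      then show "(h n u)\<^sup>2 \<le> f u * h n u"
        by (auto simp: h_def power2_eq_square indicator_def intro!: mult_right_mono)
    qed
    also have "\<dots> = (\<integral>\<^sup>+u. h n u \<partial>\<tau>)"
      unfolding f_density[symmetric] by (rule nn_integral_density[symmetric]) measurable
    finally have le: "(\<integral>\<^sup>+u. (h n u)\<^sup>2 \<partial>leb I) \<le> (\<integral>\<^sup>+u. h n u \<partial>\<tau>)" .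
    \<comment> \<open>A simple function with finite values has a finite \<tau>-integral; only then
      can one factor be cancelled in the quadratic inequality.\<close>
    have "(\<integral>\<^sup>+u. h n u \<partial>\<tau>) \<le> (\<integral>\<^sup>+u. (\<Sum>y\<in>?Y. y) \<partial>\<tau>)"
    proof (rule nn_integral_mono)
      fix u assume "u \<in> space \<tau>"
      then have u: "u \<in> space (leb I)" using sets_eq_imp_space_eq[OF \<tau>(1)] by simp
      then show "h n u \<le> (\<Sum>y\<in>?Y. y)"
        unfolding h_eq[OF u] by (intro sum_mono) (auto simp: indicator_def)
    qed
    also have "\<dots> < \<infinity>"
    proof -
      have "emeasure \<tau> (space \<tau>) < top" by (metis \<tau>.finite_emeasure_space infinity_ennreal_def top.not_eq_extremum)
      moreover have "(\<Sum>y\<in>?Y. y) < top" using finY g(3) by auto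
      ultimately show ?thesis by (simp add: ennreal_mult_less_top)
    qed
    finally have fin: "(\<integral>\<^sup>+u. h n u \<partial>\<tau>) < \<infinity>" .
    have "(\<integral>\<^sup>+u. h n u \<partial>\<tau>)\<^sup>2 \<le> C * (\<integral>\<^sup>+u. h n u \<partial>\<tau>)"
      using CS mult_left_mono[OF le, of C] by simp
    then show ?thesis
      using le ennreal_square_le_imp_le[OF _ fin] by (meson order_trans)
  qed
  have "(\<integral>\<^sup>+u. (f u)\<^sup>2 \<partial>leb I) \<le> (\<integral>\<^sup>+u. liminf (\<lambda>n. (h n u)\<^sup>2) \<partial>leb I)"
  proof (rule nn_integral_mono)
    fix u assume u: "u \<in> space (leb I)"
    have "(\<lambda>n. g n u) \<longlonglongrightarrow> f u"
      unfolding g(4)[symmetric] by (rule LIMSEQ_SUP) (use g(2) in \<open>auto simp: incseq_def le_fun_def\<close>)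
    moreover have "\<forall>\<^sub>F n in sequentially. g n u = h n u"
      using B_ev[OF u] by eventually_elim (simp add: h_def)
    ultimately have lim: "(\<lambda>n. h n u) \<longlonglongrightarrow> f u"
      by (rule Lim_transform_eventually)
    have "(\<lambda>n. h n u * h n u) \<longlonglongrightarrow> f u * f u"
      by (rule tendsto_mult_ennreal[OF lim lim]) auto
    then show "(f u)\<^sup>2 \<le> liminf (\<lambda>n. (h n u)\<^sup>2)"
      by (simp add: power2_eq_square lim_imp_Liminf)
  qed
  also have "\<dots> \<le> liminf (\<lambda>n. \<integral>\<^sup>+u. (h n u)\<^sup>2 \<partial>leb I)"
    by (rule nn_integral_liminf) (unfold h_def, measurable)
  also have "\<dots> \<le> C" using h_sq by (intro Liminf_le) auto
  also note C
  finally show ?thesis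
    unfolding in_L2_def using f f_density by (intro exI[of _ f]) auto
qed

section \<open>Stars and admissible orders\<close>

text \<open>Fatou controls just the lower limit of the energies at a given choice of centres, so the
  scales along which they stay bounded may depend on that choice. Hence the L^2 criterion is stated
  for an arbitrary sequence of scales tending to 0.\<close>

lemma liminf_finite_bounded_subsequence:
  fixes a :: "nat \<Rightarrow> ennreal"
  assumes "liminf a < \<infinity>"
  obtains r :: "nat \<Rightarrow> nat" and C where "strict_mono r" "C < \<infinity>" "\<forall>n. a (r n) \<le> C"
proof -
  obtain C where C: "liminf a < C" "C < \<infinity>" using dense[OF assms] by blast
  have "infinite {n. a n \<le> C}"
  proof
    assume "finite {n. a n \<le> C}"
    then have "\<forall>\<^sub>F n in sequentially. \<not> a n \<le> C"
      by (simp add: eventually_cofinite flip: cofinite_eq_sequentially)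
    then have "C \<le> liminf a" by (intro Liminf_bounded) (auto elim: eventually_mono)
    with C show False by simp
  qed
  from infinite_enumerate[OF this] obtain r :: "nat \<Rightarrow> nat"
    where r: "strict_mono r" "\<forall>n. r n \<in> {n. a n \<le> C}" by blast
  show thesis using that[OF r(1) C(2)] r(2) by simp
qed

lemma sets_restr_meas [simp, measurable_cong]: "sets (restr_meas \<mu> F) = sets \<mu>"
  by (simp add: restr_meas_def)

lemma space_restr_meas [simp]: "space (restr_meas \<mu> F) = space \<mu>"
  by (simp add: restr_meas_def)

lemma nn_integral_restr_meas_le:
  assumes "F \<in> sets \<mu>" "f \<in> borel_measurable \<mu>"
  shows "(\<integral>\<^sup>+x. f x \<partial>restr_meas \<mu> F) \<le> (\<integral>\<^sup>+x. f x \<partial>\<mu>)"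
  unfolding restr_meas_def using assms
  by (subst nn_integral_density) (auto intro!: nn_integral_mono simp: indicator_def)

lemma emeasure_restr_meas_le:
  assumes "F \<in> sets \<mu>" "A \<in> sets \<mu>"
  shows "emeasure (restr_meas \<mu> F) A \<le> emeasure \<mu> A"
  using nn_integral_restr_meas_le[OF assms(1), of "indicator A"] assms(2) by simp

lemma finite_measure_restr_meas:
  assumes "finite_measure \<mu>" "F \<in> sets \<mu>"
  shows "finite_measure (restr_meas \<mu> F)"
proof
  interpret finite_measure \<mu> by fact
  have "emeasure (restr_meas \<mu> F) (space \<mu>) \<le> emeasure \<mu> (space \<mu>)"
    by (rule emeasure_restr_meas_le) (use assms in auto)
  then show "emeasure (restr_meas \<mu> F) (space (restr_meas \<mu> F)) \<noteq> \<infinity>"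
    using finite_emeasure_space by (auto simp: top_unique)
qed

section \<open>Almost every choice of star centres\<close>

context frostman_measure
begin

text \<open>The energy of a star measure is a double integral over pairs (y, y') of a product over
  the arms. Integrating over the independent centres turns each arm into a slab mass, so the total
  is at most a constant times the energy in \<open>slab_energy_bound\<close> with j = card \<eta>,
  uniformly in the scale. Fatou then leaves a finite lower limit for almost every z.\<close>

lemma AE_star_in_L2:
  fixes S :: "nat \<Rightarrow> 'a set"
  assumes I: "finite I" and \<eta>: "\<eta> \<subseteq> I" and card: "real DIM('a) + real (card \<eta>) < 2 * s"
    and S: "\<And>i. S i \<in> sets borel" and F: "F \<in> sets borel"
  shows "AE z in (\<Pi>\<^sub>M i\<in>I. restr_meas \<mu> (S i)).
    in_L2 \<eta> (distr (restr_meas \<mu> F) (leb \<eta>) (\<lambda>y. \<lambda>i\<in>\<eta>. dist (z i) y))"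
proof -
  let ?M = "\<lambda>i. restr_meas \<mu> (S i)" and ?\<nu> = "restr_meas \<mu> F"
  have fin_\<eta>: "finite \<eta>" using \<eta> I by (rule finite_subset)
  have fM: "finite_measure (?M i)" for i
    by (rule finite_measure_restr_meas) (use S sets_eq finite_measure_axioms in auto)
  interpret M: product_sigma_finite ?M
    using fM by (auto simp: product_sigma_finite_def finite_measure_def)
  interpret PM: sigma_finite_measure "Pi\<^sub>M I ?M" by (rule M.sigma_finite[OF I])
  interpret \<nu>: finite_measure ?\<nu>
    by (rule finite_measure_restr_meas) (use F sets_eq finite_measure_axioms in auto)
  interpret Q: pair_sigma_finite ?\<nu> "Pi\<^sub>M I ?M" ..
  define e where "e n = 1 / (real n + 1)" for n :: nat
  have e: "e n > 0" for n by (simp add: e_def)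
  have e_lim: "e \<longlonglongrightarrow> 0" unfolding e_def by real_asymp
  define g where "g n z y y' = (\<Prod>i\<in>\<eta>. ennreal (1 / e n) * indicator {..<e n} \<bar>dist (z i) y - dist (z i) y'\<bar>)"
    for n and z :: "nat \<Rightarrow> 'a" and y y'
  have g_meas [measurable (raw)]: "(\<lambda>x. g n (a x) (b x) (c x)) \<in> borel_measurable N"
    if [measurable]: "a \<in> N \<rightarrow>\<^sub>M Pi\<^sub>M I ?M" "b \<in> borel_measurable N" "c \<in> borel_measurable N" for a b c N n
  proof -
    have [measurable]: "(\<lambda>x. a x i) \<in> borel_measurable N" if "i \<in> \<eta>" for i
    proof -
      have "(\<lambda>x. a x i) \<in> N \<rightarrow>\<^sub>M ?M i"
        using that \<eta> by (intro measurable_compose[OF \<open>a \<in> _\<close> measurable_component_singleton]) auto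
      then show ?thesis by (simp add: measurable_cong_sets[OF refl sets_restr_meas] measurable_cong_sets[OF refl sets_eq])
    qed
    show ?thesis unfolding g_def by measurable
  qed
  define energy where "energy n z = (\<integral>\<^sup>+y. \<integral>\<^sup>+y'. g n z y y' \<partial>?\<nu> \<partial>?\<nu>)" for n z
  have [measurable]: "energy n \<in> borel_measurable (Pi\<^sub>M I ?M)" for n
    unfolding energy_def by measurable
  obtain K where K: "K < \<infinity>" "\<And>\<epsilon>. \<epsilon> > 0 \<Longrightarrow>
    (\<integral>\<^sup>+p. (ennreal (1 / \<epsilon>) * emeasure \<mu> {z. \<bar>dist z (fst p) - dist z (snd p)\<bar> < \<epsilon>}) ^ card \<eta> \<partial>(\<mu> \<Otimes>\<^sub>M \<mu>)) \<le> K"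
    using slab_energy_bound[OF card] by blast
  \<comment> \<open>Centres outside \<eta> do not enter the star; each contributes at most the total
    mass.\<close>
  define W where "W = emeasure \<mu> UNIV ^ card (I - \<eta>)"
  have W: "W < \<infinity>" unfolding W_def by (simp add: emeasure_eq_measure ennreal_power)
  let ?slab = "\<lambda>n y y'. ennreal (1 / e n) * emeasure \<mu> {z. \<bar>dist z y - dist z y'\<bar> < e n}"
  have inner: "(\<integral>\<^sup>+z. g n z y y' \<partial>Pi\<^sub>M I ?M) \<le> W * ?slab n y y' ^ card \<eta>" for n y y'
  proof -
    \<comment> \<open>The value 1 off \<eta> extends the product to all of \<open>I\<close>, where
      the integral over the product measure factorises.\<close>
    let ?f = "\<lambda>i z. if i \<in> \<eta> then ennreal (1 / e n) * indicator {..<e n} \<bar>dist z y - dist z y'\<bar> else 1 :: ennreal"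
    have A: "{z. \<bar>dist z y - dist z y'\<bar> < e n} \<in> sets \<mu>"
      unfolding sets_eq by measurable
    have "(\<integral>\<^sup>+z. g n z y y' \<partial>Pi\<^sub>M I ?M) = (\<integral>\<^sup>+z. (\<Prod>i\<in>I. ?f i (z i)) \<partial>Pi\<^sub>M I ?M)"
      unfolding g_def using \<eta> I by (simp add: prod.inter_restrict[symmetric] Int_absorb1 flip: prod.inter_restrict)
    also have "\<dots> = (\<Prod>i\<in>I. \<integral>\<^sup>+z. ?f i z \<partial>?M i)"
      by (rule M.product_nn_integral_prod[OF I]) measurable
    also have "\<dots> \<le> (\<Prod>i\<in>I. if i \<in> \<eta> then ?slab n y y' else emeasure \<mu> UNIV)"
    proof (rule prod_mono_ennreal)
      fix i assume "i \<in> I"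
      have "(\<integral>\<^sup>+z. ?f i z \<partial>?M i) \<le> (\<integral>\<^sup>+z. ?f i z \<partial>\<mu>)"
        by (rule nn_integral_restr_meas_le) (use S sets_eq in auto)
      also have "\<dots> = (if i \<in> \<eta> then ?slab n y y' else emeasure \<mu> UNIV)"
      proof (cases "i \<in> \<eta>")
        case True
        have "(\<integral>\<^sup>+z. ?f i z \<partial>\<mu>) = (\<integral>\<^sup>+z. ennreal (1 / e n) * indicator {z. \<bar>dist z y - dist z y'\<bar> < e n} z \<partial>\<mu>)"
          using True by (intro nn_integral_cong) (simp add: indicator_def)
        also have "\<dots> = ?slab n y y'"
          by (rule nn_integral_cmult_indicator[OF A])
        finally show ?thesis using True by simp
      qed simp
      finally show "(\<integral>\<^sup>+z. ?f i z \<partial>?M i) \<le> (if i \<in> \<eta> then ?slab n y y' else emeasure \<mu> UNIV)" .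
    qed
    also have "\<dots> = W * ?slab n y y' ^ card \<eta>"
    proof -
      have "I \<inter> \<eta> = \<eta>" "I \<inter> - \<eta> = I - \<eta>" using \<eta> by auto
      then show ?thesis using I by (simp add: prod.If_cases W_def mult.commute)
    qed
    finally show ?thesis .
  qed
  have slab_meas [measurable]: "(\<lambda>p. emeasure \<mu> {z. \<bar>dist z (fst p) - dist z (snd p)\<bar> < e n}) \<in> borel_measurable (borel \<Otimes>\<^sub>M borel)" for n
  proof -
    have "(\<lambda>p. \<integral>\<^sup>+z. indicator {..<e n} \<bar>dist z (fst p) - dist z (snd p)\<bar> \<partial>\<mu>) \<in> borel_measurable (borel \<Otimes>\<^sub>M borel)"
      by measurable
    moreover have "(\<integral>\<^sup>+z. indicator {..<e n} \<bar>dist z (fst p) - dist z (snd p)\<bar> \<partial>\<mu>) = emeasure \<mu> {z. \<bar>dist z (fst p) - dist z (snd p)\<bar> < e n}" for p :: "'a \<times> 'a"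
    proof -
      have "(\<integral>\<^sup>+z. indicator {..<e n} \<bar>dist z (fst p) - dist z (snd p)\<bar> \<partial>\<mu>) = (\<integral>\<^sup>+z. indicator {z. \<bar>dist z (fst p) - dist z (snd p)\<bar> < e n} z \<partial>\<mu>)"
        by (intro nn_integral_cong) (simp add: indicator_def)
      also have "\<dots> = emeasure \<mu> {z. \<bar>dist z (fst p) - dist z (snd p)\<bar> < e n}"
        by (rule nn_integral_indicator) (unfold sets_eq, measurable)
      finally show ?thesis .
    qed
    ultimately show ?thesis by simp
  qed
  have slab_meas2 [measurable]: "(\<lambda>(y, y'). W * ?slab n y y' ^ card \<eta>) \<in> borel_measurable (borel \<Otimes>\<^sub>M borel)" for n
    unfolding case_prod_beta' by measurable
  have total: "(\<integral>\<^sup>+z. energy n z \<partial>Pi\<^sub>M I ?M) \<le> W * K" for n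
  proof -
    have "(\<integral>\<^sup>+z. energy n z \<partial>Pi\<^sub>M I ?M) = (\<integral>\<^sup>+y. \<integral>\<^sup>+z. \<integral>\<^sup>+y'. g n z y y' \<partial>?\<nu> \<partial>Pi\<^sub>M I ?M \<partial>?\<nu>)"
      unfolding energy_def by (rule Q.Fubini') measurable
    also have "\<dots> = (\<integral>\<^sup>+y. \<integral>\<^sup>+y'. \<integral>\<^sup>+z. g n z y y' \<partial>Pi\<^sub>M I ?M \<partial>?\<nu> \<partial>?\<nu>)"
      by (intro nn_integral_cong Q.Fubini') measurable
    also have "\<dots> \<le> (\<integral>\<^sup>+y. \<integral>\<^sup>+y'. W * ?slab n y y' ^ card \<eta> \<partial>?\<nu> \<partial>?\<nu>)"
      by (intro nn_integral_mono inner)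
    also have "\<dots> \<le> (\<integral>\<^sup>+y. \<integral>\<^sup>+y'. W * ?slab n y y' ^ card \<eta> \<partial>\<mu> \<partial>?\<nu>)"
      by (intro nn_integral_mono nn_integral_restr_meas_le) (use F sets_eq in \<open>simp_all, measurable\<close>)
    also have "\<dots> \<le> (\<integral>\<^sup>+y. \<integral>\<^sup>+y'. W * ?slab n y y' ^ card \<eta> \<partial>\<mu> \<partial>\<mu>)"
      by (intro nn_integral_restr_meas_le) (use F sets_eq in \<open>simp_all, measurable\<close>)
    also have "\<dots> = (\<integral>\<^sup>+p. (case p of (y, y') \<Rightarrow> W * ?slab n y y' ^ card \<eta>) \<partial>(\<mu> \<Otimes>\<^sub>M \<mu>))"
      by (subst nn_integral_fst[symmetric]) (auto, measurable)
    also have "\<dots> = (\<integral>\<^sup>+p. W * (ennreal (1 / e n) * emeasure \<mu> {z. \<bar>dist z (fst p) - dist z (snd p)\<bar> < e n}) ^ card \<eta> \<partial>(\<mu> \<Otimes>\<^sub>M \<mu>))"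
      by (simp add: case_prod_beta')
    also have "\<dots> = W * (\<integral>\<^sup>+p. (ennreal (1 / e n) * emeasure \<mu> {z. \<bar>dist z (fst p) - dist z (snd p)\<bar> < e n}) ^ card \<eta> \<partial>(\<mu> \<Otimes>\<^sub>M \<mu>))"
      by (rule nn_integral_cmult) measurable
    also have "\<dots> \<le> W * K"
      by (intro mult_left_mono K(2) e) simp
    finally show ?thesis .
  qed
  have "(\<integral>\<^sup>+z. liminf (\<lambda>n. energy n z) \<partial>Pi\<^sub>M I ?M) \<le> liminf (\<lambda>n. \<integral>\<^sup>+z. energy n z \<partial>Pi\<^sub>M I ?M)"
    by (rule nn_integral_liminf) measurable
  also have "\<dots> \<le> W * K" using total by (intro Liminf_le) auto
  also have "\<dots> < \<infinity>" using W K(1) by (simp add: ennreal_mult_less_top)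
  finally have "AE z in Pi\<^sub>M I ?M. liminf (\<lambda>n. energy n z) \<noteq> \<infinity>"
    by (intro nn_integral_PInf_AE) auto
  then show ?thesis
  proof eventually_elim
    case (elim z)
    then have "liminf (\<lambda>n. energy n z) < \<infinity>" by (simp add: top.not_eq_extremum)
    then obtain r :: "nat \<Rightarrow> nat" and C where r: "strict_mono r" "C < \<infinity>" "\<forall>n. energy (r n) z \<le> C"
      by (rule liminf_finite_bounded_subsequence)
    let ?\<Phi> = "\<lambda>y. \<lambda>i\<in>\<eta>. dist (z i) y"
    have \<Phi> [measurable]: "?\<Phi> \<in> ?\<nu> \<rightarrow>\<^sub>M leb \<eta>"
      unfolding leb_def by (rule measurable_restrict) measurable
    let ?\<tau> = "distr ?\<nu> (leb \<eta>) ?\<Phi>"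
    show ?case
    proof (rule in_L2_if_energy_bounded[OF fin_\<eta>])
      show "finite_measure ?\<tau>" by (rule \<nu>.finite_measure_distr[OF \<Phi>])
      show "(e \<circ> r) \<longlonglongrightarrow> 0" by (rule LIMSEQ_subseq_LIMSEQ[OF e_lim r(1)])
      show "(\<integral>\<^sup>+u. \<integral>\<^sup>+v. cube_kernel \<eta> (1 / (e \<circ> r) n) ((e \<circ> r) n) u v \<partial>?\<tau> \<partial>?\<tau>) \<le> C" for n
      proof -
        have fm: "finite_measure ?\<tau>" by (rule \<nu>.finite_measure_distr[OF \<Phi>])
        interpret T: finite_measure ?\<tau> by (rule fm)
        have "(\<integral>\<^sup>+u. \<integral>\<^sup>+v. cube_kernel \<eta> (1 / (e \<circ> r) n) ((e \<circ> r) n) u v \<partial>?\<tau> \<partial>?\<tau>) =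
           (\<integral>\<^sup>+y. \<integral>\<^sup>+v. cube_kernel \<eta> (1 / (e \<circ> r) n) ((e \<circ> r) n) (?\<Phi> y) v \<partial>?\<tau> \<partial>?\<nu>)"
          by (rule nn_integral_distr) measurable
        also have "\<dots> = (\<integral>\<^sup>+y. \<integral>\<^sup>+y'. cube_kernel \<eta> (1 / (e \<circ> r) n) ((e \<circ> r) n) (?\<Phi> y) (?\<Phi> y') \<partial>?\<nu> \<partial>?\<nu>)"
          by (intro nn_integral_cong nn_integral_distr) measurable
        also have "\<dots> = energy (r n) z"
          unfolding energy_def g_def cube_kernel_def by (simp cong: prod.cong)
        finally show ?thesis using r(3) by simp
      qed
    qed (use e r in auto)
  qed
qed

end

text \<open>Downward induction from l. At r = l, any measurable full set of prefixes satisfying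
  \<open>Q l\<close> serves. Given \<open>G (Suc k)\<close>, Fubini shows that almost every shorter
  prefix has almost all of its extensions in it, and \<open>G k\<close> collects such prefixes that
  also satisfy \<open>Q k\<close>. A prefix for r has the indices 1, ..., r - 1.\<close>

lemma iterated_good_sets:
  fixes M :: "nat \<Rightarrow> 'a measure" and Q :: "nat \<Rightarrow> (nat \<Rightarrow> 'a) \<Rightarrow> bool"
  assumes M: "product_sigma_finite M" and m: "m < l"
    and Q: "\<And>r. m < r \<Longrightarrow> r \<le> l \<Longrightarrow> AE z in Pi\<^sub>M {1..<r} M. Q r z"
  obtains G where "\<And>r. m < r \<Longrightarrow> r \<le> l \<Longrightarrow> G r \<in> sets (Pi\<^sub>M {1..<r} M)"
    and "\<And>r. m < r \<Longrightarrow> r \<le> l \<Longrightarrow> AE z in Pi\<^sub>M {1..<r} M. z \<in> G r"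
    and "\<And>r z. m < r \<Longrightarrow> r \<le> l \<Longrightarrow> z \<in> G r \<Longrightarrow> Q r z"
    and "\<And>r z. m < r \<Longrightarrow> r < l \<Longrightarrow> z \<in> G r \<Longrightarrow> AE y in M r. z(r := y) \<in> G (Suc r)"
proof -
  interpret product_sigma_finite M by fact
  \<comment> \<open>The set where \<open>Q r\<close> holds need not be measurable; a measurable full
    subset replaces it.\<close>
  have "\<exists>N. N \<in> sets (Pi\<^sub>M {1..<r} M) \<and> (AE z in Pi\<^sub>M {1..<r} M. z \<in> N) \<and> (\<forall>z\<in>N. Q r z)"
    if r: "m < r" "r \<le> l" for r
  proof -
    obtain N where N: "{z \<in> space (Pi\<^sub>M {1..<r} M). \<not> Q r z} \<subseteq> N" "N \<in> sets (Pi\<^sub>M {1..<r} M)" "emeasure (Pi\<^sub>M {1..<r} M) N = 0"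
      using Q[OF r] by (rule AE_E)
    have "AE z in Pi\<^sub>M {1..<r} M. z \<notin> N"
      using N(2,3) by (intro AE_not_in) (simp add: null_sets_def)
    then have "AE z in Pi\<^sub>M {1..<r} M. z \<in> space (Pi\<^sub>M {1..<r} M) - N"
      using AE_space by eventually_elim simp
    then show ?thesis
      using N by (intro exI[of _ "space (Pi\<^sub>M {1..<r} M) - N"]) auto
  qed
  then obtain N where N: "\<And>r. m < r \<Longrightarrow> r \<le> l \<Longrightarrow> N r \<in> sets (Pi\<^sub>M {1..<r} M)"
    "\<And>r. m < r \<Longrightarrow> r \<le> l \<Longrightarrow> AE z in Pi\<^sub>M {1..<r} M. z \<in> N r"
    "\<And>r z. m < r \<Longrightarrow> r \<le> l \<Longrightarrow> z \<in> N r \<Longrightarrow> Q r z"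
    by metis
  define P where "P G r \<longleftrightarrow> G r \<in> sets (Pi\<^sub>M {1..<r} M) \<and> (AE z in Pi\<^sub>M {1..<r} M. z \<in> G r) \<and> G r \<subseteq> N r \<and>
      (r < l \<longrightarrow> (\<forall>z\<in>G r. AE y in M r. z(r := y) \<in> G (Suc r)))" for G r
  have "\<exists>G. \<forall>r. Suc m \<le> r \<and> r \<le> l \<longrightarrow> P G r"
  proof (rule inc_induct[of "Suc m" l "\<lambda>k. \<exists>G. \<forall>r. k \<le> r \<and> r \<le> l \<longrightarrow> P G r"])
    show "Suc m \<le> l" using m by simp
    show "\<exists>G. \<forall>r. l \<le> r \<and> r \<le> l \<longrightarrow> P G r"
      using N[of l] m by (intro exI[of _ N]) (auto simp: P_def)
  next
    fix k assume k: "Suc m \<le> k" "k < l" and "\<exists>G. \<forall>r. Suc k \<le> r \<and> r \<le> l \<longrightarrow> P G r"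
    then obtain G where G: "\<And>r. Suc k \<le> r \<Longrightarrow> r \<le> l \<Longrightarrow> P G r" by blast
    have insert: "{1..<Suc k} = insert k {1..<k}" using k by auto
    have GS: "G (Suc k) \<in> sets (Pi\<^sub>M (insert k {1..<k}) M)" "AE w in Pi\<^sub>M (insert k {1..<k}) M. w \<in> G (Suc k)"
      using G[of "Suc k"] k unfolding P_def insert by auto
    note [measurable] = GS(1)
    \<comment> \<open>\<open>b z\<close> measures the values y whose extension of z leaves
      \<open>G (Suc k)\<close>. By Fubini it integrates to the measure of the complement, which is
      0.\<close>
    define b where "b z = (\<integral>\<^sup>+y. indicator (- G (Suc k)) (z(k := y)) \<partial>M k)" for z
    have ind_meas: "(\<lambda>w. indicator (- G (Suc k)) w :: ennreal) \<in> borel_measurable (Pi\<^sub>M (insert k {1..<k}) M)"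
    proof -
      have "(\<lambda>w. indicator (space (Pi\<^sub>M (insert k {1..<k}) M) - G (Suc k)) w :: ennreal) \<in> borel_measurable (Pi\<^sub>M (insert k {1..<k}) M)"
        by measurable
      then show ?thesis
        by (rule measurable_cong[THEN iffD1, rotated]) (auto simp: indicator_def)
    qed
    have upd_meas: "(\<lambda>p. indicator (- G (Suc k)) ((fst p)(k := snd p)) :: ennreal) \<in> borel_measurable (Pi\<^sub>M {1..<k} M \<Otimes>\<^sub>M M k)"
      using measurable_compose[OF measurable_add_dim ind_meas] by (simp add: case_prod_beta')
    have b_meas [measurable]: "b \<in> borel_measurable (Pi\<^sub>M {1..<k} M)"
      unfolding b_def by (rule sigma_finite_measure.borel_measurable_nn_integral[OF sigma_finite_measures]) (use upd_meas in \<open>simp add: case_prod_beta'\<close>)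
    have "(\<integral>\<^sup>+z. b z \<partial>Pi\<^sub>M {1..<k} M) = (\<integral>\<^sup>+w. indicator (- G (Suc k)) w \<partial>Pi\<^sub>M (insert k {1..<k}) M)"
      unfolding b_def by (rule product_nn_integral_insert[symmetric]) (use ind_meas in auto)
    also have "\<dots> = 0"
      by (subst nn_integral_0_iff_AE[OF ind_meas]) (use GS(2) in eventually_elim, simp)
    finally have b0: "AE z in Pi\<^sub>M {1..<k} M. b z = 0"
      using nn_integral_0_iff_AE[OF b_meas] by simp
    define H where "H = N k \<inter> {z \<in> space (Pi\<^sub>M {1..<k} M). b z = 0}"
    have Nk: "N k \<in> sets (Pi\<^sub>M {1..<k} M)" using N(1) k by simp
    have "P (G(k := H)) k"
      unfolding P_def
    proof (intro conjI impI ballI)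
      have "{z \<in> space (Pi\<^sub>M {1..<k} M). b z = 0} \<in> sets (Pi\<^sub>M {1..<k} M)" by measurable
      from sets.Int[OF Nk this] show "(G(k := H)) k \<in> sets (Pi\<^sub>M {1..<k} M)"
        by (simp only: H_def fun_upd_same)
      show "AE z in Pi\<^sub>M {1..<k} M. z \<in> (G(k := H)) k"
        using b0 N(2)[of k] k AE_space by (auto simp: H_def elim: eventually_elim2)
      show "(G(k := H)) k \<subseteq> N k" by (simp add: H_def)
      fix z assume "z \<in> (G(k := H)) k"
      then have z: "z \<in> space (Pi\<^sub>M {1..<k} M)" "b z = 0" by (auto simp: H_def)
      have "(\<lambda>y. indicator (- G (Suc k)) (z(k := y)) :: ennreal) \<in> borel_measurable (M k)"
        using measurable_compose[OF measurable_component_update[OF z(1)] ind_meas] by simp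
      from nn_integral_0_iff_AE[OF this] z(2) show "AE y in M k. z(k := y) \<in> (G(k := H)) (Suc k)"
        by (auto simp: b_def indicator_def elim!: eventually_mono split: if_splits)
    qed
    moreover have "P (G(k := H)) r" if "Suc k \<le> r" "r \<le> l" for r
      using G[OF that] that by (simp add: P_def)
    ultimately show "\<exists>G. \<forall>r. k \<le> r \<and> r \<le> l \<longrightarrow> P G r"
      by (intro exI[of _ "G(k := H)"]) (metis Suc_leI le_neq_implies_less)
  qed
  then obtain G where G: "\<And>r. m < r \<Longrightarrow> r \<le> l \<Longrightarrow> P G r" by (auto simp: Suc_le_eq)
  show thesis
  proof (rule that[of G])
    show "Q r z" if "m < r" "r \<le> l" "z \<in> G r" for r z
      using G[OF that(1,2)] N(3)[OF that(1,2)] that(3) unfolding P_def by blast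
  qed (use G in \<open>auto simp: P_def\<close>)
qed

text \<open>All back-neighbours of r precede r, so a total function z and its restriction to a
  prefix can be exchanged.\<close>

lemma cond_C_cong:
  assumes "\<And>i. 1 \<le> i \<Longrightarrow> i < r \<Longrightarrow> z i = z' i"
  shows "cond_C \<mu> E adj v r z = cond_C \<mu> E adj v r z'"
proof -
  have "(\<lambda>y. \<lambda>i\<in>eta adj v r. dist (z i) y) = (\<lambda>y. \<lambda>i\<in>eta adj v r. dist (z' i) y)"
    using assms by (auto simp: eta_def fun_eq_iff)
  then show ?thesis by (simp add: cond_C_def)
qed

theorem theorem6p3:
  fixes V :: "'v set" and adj :: "'v \<Rightarrow> 'v \<Rightarrow> bool" and P :: "'v set"
    and k m l :: nat and v :: "nat \<Rightarrow> 'v"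
    and E :: "'a::euclidean_space set" and \<mu> :: "'a measure" and s :: real
    and Es :: "nat \<Rightarrow> 'a set"
  assumes "k_admissible_pinned k V adj P"
    and "m = card P" and "m \<ge> 1"
    and "k_admissible_order k V adj P m l v"
    and "compact E"
    and "hausdorff_dim E > (real DIM('a) + real k) / 2"
    and "frostman s \<mu> E" and "s > (real DIM('a) + real k) / 2"
    and "\<forall>i\<in>{1..l}. compact (Es i) \<and> Es i \<subseteq> E \<and> emeasure \<mu> (Es i) > 0"
    and "\<forall>i\<in>{1..l}. \<forall>j\<in>{1..l}. i \<noteq> j \<longrightarrow> setdist (Es i) (Es j) > 0"
  shows "AE x in (\<Pi>\<^sub>M i\<in>{1..m}. restr_meas \<mu> (Es i)). good \<mu> Es adj v m l x"
proof (cases "m < l")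
  case False
  \<comment> \<open>Without vertices after the pins both clauses of goodness are vacuous.\<close>
  then have "\<not> (m + 1 \<le> r \<and> r \<le> l - 1 \<and> A)" for r A by auto
  then have "good \<mu> Es adj v m l x" for x
    unfolding good_def using False by blast
  then show ?thesis by simp
next
  case ml: True
  note frost = \<open>frostman s \<mu> E\<close>[unfolded frostman_def]
  have sets_eq: "sets \<mu> = sets borel" using frost by blast
  have space_eq: "space \<mu> = UNIV" using sets_eq_imp_space_eq[OF sets_eq] by simp
  obtain C where C: "\<And>x r. r > 0 \<Longrightarrow> measure \<mu> (ball x r) \<le> C * r powr s"
    using frost by blast
  obtain D where D: "D > 0" "\<And>x. x \<in> E \<Longrightarrow> norm x \<le> D"
    using compact_imp_bounded[OF \<open>compact E\<close>] bounded_pos by metis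
  interpret finite_measure \<mu>
    by standard (use frost in \<open>auto simp: space_eq\<close>)
  interpret frostman_measure \<mu> s D C
  proof
    show "AE z in \<mu>. norm z \<le> D"
    proof (rule AE_I)
      show "{z \<in> space \<mu>. \<not> norm z \<le> D} \<subseteq> UNIV - E" using D(2) by auto
      show "emeasure \<mu> (UNIV - E) = 0" using frost by blast
      show "UNIV - E \<in> sets \<mu>"
        using compact_imp_closed[OF \<open>compact E\<close>] by (simp add: sets_eq)
    qed
  qed (use sets_eq D(1) C in auto)
  \<comment> \<open>Outside 1, ..., l the family is filled up with the whole space, so that every
    index carries a finite Borel measure and the product measures are available.\<close>
  define S where "S i = (if i \<in> {1..l} then Es i else UNIV)" for i
  have S_borel: "S i \<in> sets borel" for i
    using assms(9) by (auto simp: S_def intro: borel_compact)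
  let ?M = "\<lambda>i. restr_meas \<mu> (S i)"
  have fM: "finite_measure (?M i)" for i
    by (rule finite_measure_restr_meas) (use S_borel sets_eq finite_measure_axioms in auto)
  have M: "product_sigma_finite ?M"
    using fM by (auto simp: product_sigma_finite_def finite_measure_def)
  have Q: "AE z in Pi\<^sub>M {1..<r} ?M. cond_C \<mu> Es adj v r z" if r: "m < r" "r \<le> l" for r
    unfolding cond_C_def
  proof (rule AE_star_in_L2)
    show "eta adj v r \<subseteq> {1..<r}" by (auto simp: eta_def)
    \<comment> \<open>Back-degree at most k together with 2s > d + k puts every star below the
      threshold of the energy bound.\<close>
    have "card (eta adj v r) \<le> k"
      using assms(4) r by (auto simp: k_admissible_order_def)
    then show "real DIM('a) + real (card (eta adj v r)) < 2 * s"
      using assms(8) by simp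
    show "Es r \<in> sets borel" using assms(9) r \<open>m \<ge> 1\<close> by (auto intro: borel_compact)
  qed (use S_borel in auto)
  obtain G where G_sets: "\<And>r. m < r \<Longrightarrow> r \<le> l \<Longrightarrow> G r \<in> sets (Pi\<^sub>M {1..<r} ?M)"
    and G_AE: "\<And>r. m < r \<Longrightarrow> r \<le> l \<Longrightarrow> AE z in Pi\<^sub>M {1..<r} ?M. z \<in> G r"
    and G_cond: "\<And>r z. m < r \<Longrightarrow> r \<le> l \<Longrightarrow> z \<in> G r \<Longrightarrow> cond_C \<mu> Es adj v r z"
    and G_step: "\<And>r z. m < r \<Longrightarrow> r < l \<Longrightarrow> z \<in> G r \<Longrightarrow> AE y in ?M r. z(r := y) \<in> G (Suc r)"
    using iterated_good_sets[where M="?M" and Q="cond_C \<mu> Es adj v", OF M ml Q] by blast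
  have "AE x in Pi\<^sub>M {1..m} ?M. x \<in> G (Suc m)"
    using G_AE[of "Suc m"] ml unfolding atLeastLessThanSuc_atLeastAtMost by simp
  moreover have "Pi\<^sub>M {1..m} ?M = (\<Pi>\<^sub>M i\<in>{1..m}. restr_meas \<mu> (Es i))"
    using ml by (intro PiM_cong) (auto simp: S_def)
  ultimately have "AE x in (\<Pi>\<^sub>M i\<in>{1..m}. restr_meas \<mu> (Es i)). x \<in> G (Suc m)" by (simp only:)
  then show ?thesis
  proof eventually_elim
    case (elim x)
    \<comment> \<open>The fibre of \<open>G (Suc r)\<close> over the prefix w. Choosing each new
      point in its fibre keeps the prefixes inside G, which is the invariant
      \<open>in_G\<close>.\<close>
    define F where "F r w = {y \<in> Es r. w(r := y) \<in> G (Suc r)}" for r w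
    have x_ext: "restrict x {1..<Suc m} = x"
      using sets.sets_into_space[OF G_sets[of "Suc m"]] elim ml
      by (auto simp: space_PiM PiE_restrict)
    have upd: "restrict z {1..<Suc r} = (restrict z {1..<r})(r := z r)" if "m < r" for z :: "nat \<Rightarrow> 'a" and r
      using that \<open>m \<ge> 1\<close> by (auto simp: fun_eq_iff restrict_def)
    have in_G: "restrict z {1..<r} \<in> G r" if "m < r" "r \<le> l" "admissible_upto m x F r z" for r z
      using that
    proof (induction r)
      case (Suc r)
      show ?case
      proof (cases "r = m")
        case True
        have "restrict z {1..<Suc m} = restrict x {1..<Suc m}"
          using Suc.prems(3) True by (auto simp: admissible_upto_def fun_eq_iff restrict_def)
        then show ?thesis using x_ext elim True by simp
      next
        case False
        then have r: "m < r" using Suc.prems(1) by simp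
        have "z r \<in> F r (restrict z {1..<r})"
          using Suc.prems(3) r by (auto simp: admissible_upto_def)
        then show ?thesis unfolding upd[OF r] F_def by blast
      qed
    qed simp
    show "good \<mu> Es adj v m l x"
      unfolding good_def
    proof (intro conjI impI exI[of _ F] allI ballI)
      show "cond_C \<mu> Es adj v (m + 1) x" using G_cond[OF _ _ elim] ml by simp
    next
      fix r z assume "m + 1 \<le> r \<and> r \<le> l - 1 \<and> admissible_upto m x F r z"
      then have r: "m < r" "r < l" "r \<le> l" and adm: "admissible_upto m x F r z" using ml by auto
      let ?w = "restrict z {1..<r}"
      have w: "?w \<in> G r" by (rule in_G[OF r(1,3) adm])
      have Sr: "S r = Es r" using r by (simp add: S_def)
      have Er: "Es r \<in> sets borel" using S_borel[of r] by (simp add: Sr)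
      have upd_meas: "(\<lambda>y. ?w(r := y)) \<in> ?M r \<rightarrow>\<^sub>M Pi\<^sub>M (insert r {1..<r}) ?M"
        using sets.sets_into_space[OF G_sets[OF r(1,3)]] w
        by (intro measurable_component_update) (blast, simp)
      have ins: "insert r {1..<r} = {1..<Suc r}" using r by auto
      have "(\<lambda>y. ?w(r := y)) -` G (Suc r) \<inter> space (?M r) \<in> sets (?M r)"
        using measurable_sets[OF upd_meas, of "G (Suc r)"] G_sets[of "Suc r"] r by (simp only: ins)
      then have "(\<lambda>y. ?w(r := y)) -` G (Suc r) \<in> sets borel"
        by (simp add: sets_eq)
      then have "Es r \<inter> (\<lambda>y. ?w(r := y)) -` G (Suc r) \<in> sets borel"
        using Er by (rule sets.Int[rotated])
      then show F_borel: "F r ?w \<in> sets borel"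
        by (simp add: F_def vimage_def Int_def)
      show "F r ?w \<subseteq> Es r" by (auto simp: F_def)
      \<comment> \<open>Almost everywhere for the restricted measure means at \<mu>-almost every
        point of \<open>Es r\<close>; so the fibre has full measure in \<open>Es r\<close>.\<close>
      have "indicator (Es r) \<in> borel_measurable \<mu>"
        using Er sets_eq by simp
      from G_step[OF r(1,2) w, unfolded restr_meas_def Sr AE_density[OF this]]
      have "AE y in \<mu>. y \<in> Es r \<longrightarrow> ?w(r := y) \<in> G (Suc r)"
        by eventually_elim simp
      then show "emeasure \<mu> (F r ?w) = emeasure \<mu> (Es r)"
        using F_borel Er sets_eq by (intro emeasure_eq_AE) (auto simp: F_def elim: eventually_mono)
      fix y assume y: "y \<in> F r ?w"
      then have "?w(r := y) \<in> G (Suc r)" by (simp add: F_def)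
      then have "cond_C \<mu> Es adj v (Suc r) (?w(r := y))"
        using G_cond[of "Suc r"] r by simp
      moreover have "cond_C \<mu> Es adj v (Suc r) (?w(r := y)) = cond_C \<mu> Es adj v (Suc r) (z(r := y))"
        by (rule cond_C_cong) auto
      ultimately show "cond_C \<mu> Es adj v (r + 1) (z(r := y))" by simp
    qed
  qed
qed

end
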